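(* For $\alpha\in[0,1)$ let $k(\alpha)$ denote the smallest constant such that $$\Bigl(\sum_{k=1}^\infty a_k\Bigr)^2\le k(\alpha)\Bigl(\sum_{k=1}^\infty a_k^2\Bigr)^{1/2}\Bigl(\sum_{k=1}^\infty(k-\alpha)^2a_k^2\Bigr)^{1/2}$$ for all real sequences $\{a_k\}$ with finite right-hand side. (i) For $\alpha\in[0,1/2)$ the inequality $$\Bigl(\sum_{k=1}^\infty a_k\Bigr)^2\le\pi\Bigl(\sum_{k=1}^\infty a_k^2\Bigr)^{1/2}\Bigl(\sum_{k=1}^\infty(k-\alpha)^2a_k^2\Bigr)^{1/2}-(1-2\alpha)\sum_{k=1}^\infty a_k^2$$ holds; the constants $\pi$ and $1-2\alpha$ are sharp and no extremals exist. (ii) For $\alpha\in(1/2,1)$, $$k(\alpha)=\max_{\lambda>0}\, i\bigl(\psi(1-\alpha-i\sqrt\lambda)-\psi(1-\alpha+i\sqrt\lambda)\bigr),$$ the maximum is attained at a unique point $\lambda_*(\alpha)$, and there exists a unique extremal $a_k=\frac1{(k-\alpha)^2+\lambda_*(\alpha)}$.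
   Context: $\psi(z)=\frac{d}{dz}\log\Gamma(z)$ is the digamma function. *)

theory Defs
  imports "HOL-Analysis.Analysis"
begin

(* A real sequence {a_k}_{k>=1} is represented as a :: nat => real with a n = a_{n+1}.
   Hence the weight (k - alpha) for the index k = n+1 is (real (Suc n) - alpha). *)

definition sq_sum :: "(nat \<Rightarrow> real) \<Rightarrow> real" where
  "sq_sum a = (\<Sum>n. (a n)^2)"

definition wsq_sum :: "real \<Rightarrow> (nat \<Rightarrow> real) \<Rightarrow> real" where
  "wsq_sum \<alpha> a = (\<Sum>n. ((real (Suc n) - \<alpha>) * a n)^2)"

definition admissible :: "real \<Rightarrow> (nat \<Rightarrow> real) \<Rightarrow> bool" where
  "admissible \<alpha> a \<longleftrightarrow> summable (\<lambda>n. (a n)^2) \<and> summable (\<lambda>n. ((real (Suc n) - \<alpha>) * a n)^2)"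

(* the set of admissible constants C in the Carlson-type inequality; k(alpha) is its least element *)
definition carlson_consts :: "real \<Rightarrow> real set" where
  "carlson_consts \<alpha> = {C. \<forall>a. admissible \<alpha> a \<longrightarrow>
       (suminf a)^2 \<le> C * sqrt (sq_sum a) * sqrt (wsq_sum \<alpha> a)}"

(* i (psi(1-alpha - i sqrt lambda) - psi(1-alpha + i sqrt lambda)); this quantity is real,
   we take its real part *)
definition psi_expr :: "real \<Rightarrow> real \<Rightarrow> real" where
  "psi_expr \<alpha> l = Re (\<i> * (Digamma (Complex (1 - \<alpha>) (- sqrt l))
                              - Digamma (Complex (1 - \<alpha>) (sqrt l))))"

end

(* With x_n = n + s and s = 1 - alpha, the Cauchy-Schwarz inequality with weights x_n^2 + t^2 bounds
   (sum a_n)^2 by (B + t^2 A) L(t), where A and B are the two quadratic sums and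
   L(t) = sum 1 / (x_n^2 + t^2).  Moreover t L(t) = Im psi(s + i t), a harmonic function of (s, t).

   For s > 1/2, the maximum principle on a quadrant gives Im psi(z + 1/2) <= arg z; on the imaginary
   axis this is (pi/2) tanh(pi t) <= pi/2.  With theta = arg z it turns the required bound on L into
   4 theta^2 + 8 theta cot theta < pi^2 on (0, pi/2).

   For s < 1/2, the best constant is max 2 t L(t), and any critical point satisfies Re psi'(s + i t) = 0.
   By the reflection formula cosh^2(pi t) Re psi'(1 - s + i t) is then an explicit strictly decreasing
   function of t.  The maximum principle on the right half-plane, applied to sums of vertical
   translates of psi', shows that this quantity is nondecreasing in t; so there is at most one zero. *)

theory Submission
  imports Defs "HOL-Complex_Analysis.Complex_Analysis" "HOL-Real_Asymp.Real_Asymp"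
begin

section \<open>Lorentzian sums and the digamma function\<close>

text \<open>Both maximum principle arguments use the line Re z = 1/2 as boundary because there 1 - z
  is the conjugate of z: the reflection formulas then give Im psi and Re psi' in closed form, as a
  multiple of tanh and of sech^2. Both domains are unbounded, so each comparison runs on a bounded
  piece, with an arbitrarily small error \<eta> on the outer arc.

  For s > 1/2 put c = 2 s - 1. The defect term is absorbed by linking the AM-GM parameter r to t
  through t^2 = r^2 - 2 c r / pi. Under this link the condition 2 r L < pi becomes 4 t^2 L^2 + 4 c L
  < pi^2. It is strict for each t, which excludes extremals, but for large t no room is left for a
  larger c, which gives sharpness.

  For s < 1/2 the obstacle is uniqueness: the terms of the series for Re psi' change sign with t, so
  unimodality of t L(t) cannot be read off. Reflection moves the question to 1 - s > 1/2. The factor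
  cosh^2(pi t) is the one that makes the product constant in t on the line Re z = 1/2.\<close>

definition lorentz_sum :: "real \<Rightarrow> real \<Rightarrow> real" where
  "lorentz_sum s t = (\<Sum>n. 1 / ((real n + s)\<^sup>2 + t\<^sup>2))"

lemma summable_inverse_shift_square:
  assumes "s > 0"
  shows "summable (\<lambda>n. 1 / (real n + s)\<^sup>2)"
  using Polygamma_converges'[of s 2] assms by (simp add: add.commute inverse_eq_divide)

lemma summable_lorentz:
  assumes "s > 0"
  shows "summable (\<lambda>n. 1 / ((real n + s)\<^sup>2 + t\<^sup>2))"
proof (rule summable_comparison_test'[OF summable_inverse_shift_square[OF assms]])
  fix n :: nat
  have "real n + s > 0" using assms by simp
  then show "norm (1 / ((real n + s)\<^sup>2 + t\<^sup>2)) \<le> 1 / (real n + s)\<^sup>2"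
    by (auto intro!: divide_left_mono add_pos_nonneg mult_pos_pos)
qed

lemma lorentz_sum_pos:
  assumes "s > 0"
  shows "lorentz_sum s t > 0"
  unfolding lorentz_sum_def
  using assms by (intro suminf_pos summable_lorentz) (auto intro!: divide_pos_pos add_pos_nonneg)

lemma Im_Digamma:
  assumes "s > 0"
  shows "Im (Digamma (Complex s t)) = t * lorentz_sum s t"
proof -
  let ?z = "Complex s t"
  have nz: "?z \<noteq> 0" using assms by (auto simp: complex_eq_iff)
  have "(\<lambda>k. inverse (of_nat (Suc k)) - inverse (?z + of_nat k)) sums
      (Digamma ?z + euler_mascheroni)"
    using summable_Digamma[OF nz] by (simp add: Digamma_def summable_sums)
  note sums = sums_Im[OF this]
  have Im_euler: "Im (euler_mascheroni :: complex) = 0"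
    by (metis of_real_euler_mascheroni Im_complex_of_real)
  from sums
  have "(\<lambda>k. Im (inverse (of_nat (Suc k)) - inverse (?z + of_nat k))) sums Im (Digamma ?z)"
    by (simp add: Im_euler)
  moreover have "Im (inverse (of_nat (Suc k)) - inverse (?z + of_nat k)) =
      t * (1 / ((real k + s)\<^sup>2 + t\<^sup>2))" for k
    by (simp add: add.commute[of s] del: of_nat_Suc)
  ultimately have "(\<lambda>k. t * (1 / ((real k + s)\<^sup>2 + t\<^sup>2))) sums Im (Digamma ?z)"
    by (simp only:)
  then show ?thesis
    unfolding lorentz_sum_def using suminf_mult[OF summable_lorentz[OF assms, of t], of t]
    by (simp add: sums_iff)
qed

lemma psi_expr_eq:
  assumes "\<alpha> < 1"
  shows "psi_expr \<alpha> l = 2 * (sqrt l * lorentz_sum (1 - \<alpha>) (sqrt l))"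
  using assms by (simp add: psi_expr_def Im_Digamma) (simp add: lorentz_sum_def)

section \<open>Reflection formulas and their real forms\<close>

lemma not_nonpos_Ints: "Re z > 0 \<Longrightarrow> z \<notin> \<int>\<^sub>\<le>\<^sub>0"
  by (auto elim!: nonpos_Ints_cases')

text \<open>Both sides come from differentiating
  \<open>rGamma z * rGamma (1 - z) = sin (pi * z) / pi\<close>, once by the product rule and once in
  closed form.\<close>

lemma Digamma_reflection:
  fixes z :: complex
  assumes "0 < Re z" "Re z < 1"
  shows "(Digamma (1 - z) - Digamma z) * sin (pi * z) = pi * cos (pi * z)"
proof -
  have z: "z \<notin> \<int>\<^sub>\<le>\<^sub>0" "1 - z \<notin> \<int>\<^sub>\<le>\<^sub>0" using assms by (auto intro!: not_nonpos_Ints)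
  have "((\<lambda>z. rGamma z * rGamma (1 - z)) has_field_derivative
      rGamma z * rGamma (1 - z) * (Digamma (1 - z) - Digamma z)) (at z)"
    using z by (auto intro!: derivative_eq_intros simp: algebra_simps)
  moreover have "((\<lambda>z. rGamma z * rGamma (1 - z :: complex)) has_field_derivative cos (pi * z)) (at z)"
    unfolding rGamma_reflection_complex by (auto intro!: derivative_eq_intros)
  ultimately have "rGamma z * rGamma (1 - z) * (Digamma (1 - z) - Digamma z) = cos (pi * z)"
    by (rule DERIV_unique)
  then show ?thesis
    by (simp add: rGamma_reflection_complex field_simps)
qed

lemma Trigamma_reflection:
  fixes z :: complex
  assumes "0 < Re z" "Re z < 1"
  shows "(Polygamma 1 z + Polygamma 1 (1 - z)) * (sin (pi * z))\<^sup>2 = (of_real pi)\<^sup>2"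
proof -
  let ?S = "{z. 0 < Re z} \<inter> {z. Re z < 1}"
  have S: "open ?S" by (intro open_Int open_halfspace_Re_gt open_halfspace_Re_lt)
  have z: "z \<notin> \<int>\<^sub>\<le>\<^sub>0" "1 - z \<notin> \<int>\<^sub>\<le>\<^sub>0" using assms by (auto intro!: not_nonpos_Ints)
  let ?D = "Digamma (1 - z) - Digamma z" and ?T = "Polygamma 1 z + Polygamma 1 (1 - z)"
  have 1: "((\<lambda>z. (Digamma (1 - z) - Digamma z) * sin (pi * z)) has_field_derivative
      (?D * (pi * cos (pi * z)) - ?T * sin (pi * z))) (at z)"
    using z by (auto intro!: derivative_eq_intros simp: algebra_simps)
  have 2: "((\<lambda>z. (Digamma (1 - z) - Digamma z) * sin (pi * z)) has_field_derivative
      (- (of_real pi)\<^sup>2 * sin (pi * z))) (at z)"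
  proof (rule has_field_derivative_transform_within_open[OF _ S])
    show "((\<lambda>z. pi * cos (pi * z)) has_field_derivative (- (of_real pi)\<^sup>2 * sin (pi * z))) (at z)"
      by (auto intro!: derivative_eq_intros simp: power2_eq_square)
  qed (use assms in \<open>auto simp: Digamma_reflection\<close>)
  have D: "?D * sin (pi * z) = pi * cos (pi * z)" using Digamma_reflection[OF assms] .
  \<comment> \<open>Differentiating leaves a term with \<open>?D\<close> and \<open>cos\<close>. One
    more factor \<open>sin (pi * z)\<close> lets the digamma identity \<open>D\<close> replace
    it.\<close>
  have "(?D * (pi * cos (pi * z)) - ?T * sin (pi * z)) * sin (pi * z) =
      - (of_real pi)\<^sup>2 * sin (pi * z) * sin (pi * z)"
    using DERIV_unique[OF 1 2] by simp
  then have "?T * (sin (pi * z))\<^sup>2 = (?D * sin (pi * z)) * (pi * cos (pi * z)) + (of_real pi)\<^sup>2 * (sin (pi * z))\<^sup>2"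
    by (simp add: algebra_simps power2_eq_square)
  also have "\<dots> = (of_real pi)\<^sup>2 * ((cos (pi * z))\<^sup>2 + (sin (pi * z))\<^sup>2)"
    unfolding D by (simp only: algebra_simps power2_eq_square)
  finally show ?thesis by simp
qed

lemma sin_mult_Complex:
  "sin (complex_of_real c * Complex x y) = Complex (sin (c * x) * cosh (c * y)) (cos (c * x) * sinh (c * y))"
  "cos (complex_of_real c * Complex x y) = Complex (cos (c * x) * cosh (c * y)) (- sin (c * x) * sinh (c * y))"
  by (auto simp: complex_eq_iff Re_sin Im_sin Re_cos Im_cos cosh_def sinh_def exp_minus field_simps)

lemma lorentz_sum_reflection:
  assumes "0 < s" "s < 1" "t > 0"
  shows "t * lorentz_sum s t + t * lorentz_sum (1 - s) t =
    pi * sinh (pi * t) * cosh (pi * t) / ((sin (pi * s))\<^sup>2 + (sinh (pi * t))\<^sup>2)"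
proof -
  let ?z = "Complex s t" and ?s = "sin (pi * s)" and ?c = "cos (pi * s)"
  and ?sh = "sinh (pi * t)" and ?ch = "cosh (pi * t)"
  define W where "W = Digamma (1 - ?z) - Digamma ?z"
  have 1: "1 - ?z = Complex (1 - s) (- t)" by (simp add: complex_eq_iff)
  have ImW: "Im W = - (t * lorentz_sum s t + t * lorentz_sum (1 - s) t)"
    unfolding W_def 1 using assms by (simp add: Im_Digamma) (simp add: lorentz_sum_def)
  have "W * sin (pi * ?z) = pi * cos (pi * ?z)"
    unfolding W_def using Digamma_reflection[of ?z] assms by simp
  then have eq: "W * Complex (?s * ?ch) (?c * ?sh) = pi * Complex (?c * ?ch) (- ?s * ?sh)"
    unfolding sin_mult_Complex .
  have R: "Re W * (?s * ?ch) - Im W * (?c * ?sh) = pi * (?c * ?ch)"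
    using arg_cong[OF eq, of Re] by simp
  have I: "Re W * (?c * ?sh) + Im W * (?s * ?ch) = - pi * (?s * ?sh)"
    using arg_cong[OF eq, of Im] by simp
  \<comment> \<open>Eliminate \<open>Re W\<close> from the linear system \<open>R\<close>,
    \<open>I\<close>. The determinant that appears is |sin(pi z)|^2, which \<open>B\<close> rewrites
    as \<open>?s\<^sup>2 + ?sh\<^sup>2\<close>.\<close>
  have "Im W * ((?s * ?ch)\<^sup>2 + (?c * ?sh)\<^sup>2) =
      (Re W * (?c * ?sh) + Im W * (?s * ?ch)) * (?s * ?ch) - (Re W * (?s * ?ch) - Im W * (?c * ?sh)) * (?c * ?sh)"
    by (simp add: algebra_simps power2_eq_square)
  also have "\<dots> = - pi * ?sh * ?ch * (?s\<^sup>2 + ?c\<^sup>2)"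
    unfolding R I by algebra
  finally have A: "Im W * ((?s * ?ch)\<^sup>2 + (?c * ?sh)\<^sup>2) = - pi * ?sh * ?ch" by simp
  have B: "(?s * ?ch)\<^sup>2 + (?c * ?sh)\<^sup>2 = ?s\<^sup>2 + ?sh\<^sup>2"
    unfolding power_mult_distrib cosh_square_eq cos_squared_eq by algebra
  have "?s\<^sup>2 + ?sh\<^sup>2 > 0" using assms by (intro add_nonneg_pos) auto
  moreover have "(t * lorentz_sum s t + t * lorentz_sum (1 - s) t) * (?s\<^sup>2 + ?sh\<^sup>2) = pi * ?sh * ?ch"
    using A ImW unfolding B by algebra
  ultimately show ?thesis by (subst nonzero_eq_divide_eq) linarith+
qed

lemma lorentz_sum_half:
  assumes "t > 0"
  shows "t * lorentz_sum (1/2) t = pi / 2 * tanh (pi * t)"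
proof -
  have "2 * (t * lorentz_sum (1/2) t) = pi * sinh (pi * t) * cosh (pi * t) / (cosh (pi * t))\<^sup>2"
    using lorentz_sum_reflection[of "1/2" t] assms by (simp add: cosh_square_eq add.commute)
  then show ?thesis by (simp add: tanh_def power2_eq_square)
qed

section \<open>Telescoping bounds\<close>

text \<open>For closed \<open>S\<close> the frontier is \<open>S\<close> without its interior. In
  this form a boundary point is located by exhibiting an explicit open subset of \<open>S\<close>
  that it must avoid.\<close>

lemma max_principle_Re:
  assumes "f holomorphic_on S" "closed S" "bounded S"
    and "\<And>z. z \<in> S \<Longrightarrow> z \<notin> interior S \<Longrightarrow> Re (f z) \<le> B" and "z \<in> S"
  shows "Re (f z) \<le> B"
proof (rule maximum_real_frontier[OF _ _ \<open>bounded S\<close> _ \<open>z \<in> S\<close>])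
  show "f holomorphic_on interior S"
    using assms(1) interior_subset by (rule holomorphic_on_subset)
  show "continuous_on (closure S) f"
    using assms(1,2) by (simp add: holomorphic_on_imp_continuous_on)
qed (use assms in \<open>auto simp: frontier_def\<close>)

lemma arctan_diff_ge:
  fixes t x :: real
  assumes "t > 0" "x \<ge> 0"
  shows "t / ((x + 1)\<^sup>2 + t\<^sup>2) \<le> arctan ((x + 1) / t) - arctan (x / t)"
proof -
  have "\<exists>z>x. z < x + 1 \<and> arctan ((x + 1) / t) - arctan (x / t) = (x + 1 - x) * (t / (z\<^sup>2 + t\<^sup>2))"
  proof (rule MVT2)
    fix z assume "x \<le> z" "z \<le> x + 1"
    show "((\<lambda>z. arctan (z / t)) has_real_derivative t / (z\<^sup>2 + t\<^sup>2)) (at z)"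
      using assms by (auto intro!: derivative_eq_intros simp: field_simps power2_eq_square)
  qed simp
  then obtain z where z: "x < z" "z < x + 1"
    and eq: "arctan ((x + 1) / t) - arctan (x / t) = t / (z\<^sup>2 + t\<^sup>2)" by auto
  have "z\<^sup>2 \<le> (x + 1)\<^sup>2" using z assms by (intro power_mono) auto
  then show ?thesis unfolding eq using assms
    by (intro divide_left_mono mult_pos_pos add_nonneg_pos add_right_mono) auto
qed

text \<open>The difference d lies in [0, pi/2), its tangent is the right-hand side by the
  subtraction formula, and d \<le> tan d.\<close>

lemma arctan_diff_le:
  fixes p q :: real
  assumes "0 \<le> q" "q \<le> p"
  shows "arctan p - arctan q \<le> (p - q) / (1 + p * q)"
proof -
  let ?d = "arctan p - arctan q"
  have d: "0 \<le> ?d" "?d < pi / 2"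
    using assms arctan_monotone'[of q p] arctan_bounded[of p] by (auto simp: diff_less_eq add_strict_increasing2)
      (smt (verit) zero_le_arctan_iff)
  have "cos ?d > 0" using d by (intro cos_gt_zero_pi) auto
  then have "tan ?d = (p - q) / (1 + p * q)"
    by (subst tan_diff) (auto simp: tan_arctan)
  moreover have "?d \<le> tan ?d"
    using abs_tan_ge[of ?d] d tan_gt_zero[of ?d] by (cases "?d = 0") auto
  ultimately show ?thesis by simp
qed

lemma arctan_shift_telescope:
  fixes t x :: real
  assumes "t > 0"
  shows "(\<lambda>n. arctan ((real n + x + 1) / t) - arctan ((real n + x) / t)) sums (pi / 2 - arctan (x / t))"
proof -
  have "filterlim (\<lambda>n. (real n + x) / t) at_top sequentially"
    using assms by real_asymp
  then have "(\<lambda>n. arctan ((real n + x) / t)) \<longlonglongrightarrow> pi / 2"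
    by (rule filterlim_compose[OF tendsto_arctan_at_top])
  from telescope_sums[OF this] show ?thesis by (simp add: algebra_simps)
qed

lemma arctan_complement:
  fixes x y :: real
  assumes "x > 0" "y > 0"
  shows "pi / 2 - arctan (x / y) = arctan (y / x)"
  using arctan_inverse[of "x / y"] assms by (simp add: sgn_if)

text \<open>Every term but the first is at most the integral of t / (x^2 + t^2) over the unit
  interval to its left. The surplus first term is at most 1 / t, which is harmless on large arcs and
  for large t.\<close>

lemma lorentz_sum_le_arctan:
  assumes "s > 0" "t > 0"
  shows "t * lorentz_sum s t \<le> t / (s\<^sup>2 + t\<^sup>2) + arctan (t / s)"
proof -
  let ?f = "\<lambda>n. t / ((real n + s)\<^sup>2 + t\<^sup>2)"
  have sm: "summable ?f" using summable_mult[OF summable_lorentz[of s t], of t] assms by simp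
  have "t * lorentz_sum s t = suminf ?f"
    unfolding lorentz_sum_def by (subst suminf_mult[symmetric]) (use assms in \<open>auto intro!: summable_lorentz\<close>)
  also have "\<dots> = (\<Sum>n. ?f (Suc n)) + t / (s\<^sup>2 + t\<^sup>2)"
    using suminf_split_head[OF sm] by simp
  also have "(\<Sum>n. ?f (Suc n)) \<le> (\<Sum>n. arctan ((real n + s + 1) / t) - arctan ((real n + s) / t))"
  proof (rule suminf_le)
    show "?f (Suc n) \<le> arctan ((real n + s + 1) / t) - arctan ((real n + s) / t)" for n
      using arctan_diff_ge[of t "real n + s"] assms by (simp add: add.commute add.left_commute)
    show "summable (\<lambda>n. ?f (Suc n))" using sm summable_Suc_iff[of ?f] by blast
  qed (use arctan_shift_telescope[OF \<open>t > 0\<close>] in \<open>rule sums_summable\<close>)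
  also have "\<dots> = arctan (t / s)"
    using sums_unique[OF arctan_shift_telescope[OF \<open>t > 0\<close>, of s]] arctan_complement[OF assms] by simp
  finally show ?thesis by simp
qed

text \<open>The shift from t to T makes the tangent bound exact: for nodes x - 1/2 and x + 1/2 one
  has T^2 + (x - 1/2)(x + 1/2) = x^2 + t^2, so \<open>arctan_diff_le\<close> produces precisely the
  Lorentzian terms.\<close>

lemma lorentz_sum_ge_arctan:
  fixes s t :: real
  assumes "s \<ge> 1/2"
  defines "T \<equiv> sqrt (t\<^sup>2 + 1/4)"
  shows "T * lorentz_sum s t \<ge> pi / 2 - arctan ((s - 1/2) / T)"
proof -
  have T: "T > 0" "T\<^sup>2 = t\<^sup>2 + 1/4" unfolding T_def by (auto intro!: add_nonneg_pos simp: add_nonneg_nonneg)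
  have "pi / 2 - arctan ((s - 1/2) / T) =
      (\<Sum>n. arctan ((real n + (s - 1/2) + 1) / T) - arctan ((real n + (s - 1/2)) / T))"
    using arctan_shift_telescope[OF T(1), of "s - 1/2"] by (simp add: sums_iff)
  also have "\<dots> \<le> (\<Sum>n. T * (1 / ((real n + s)\<^sup>2 + t\<^sup>2)))"
  proof (rule suminf_le)
    fix n
    let ?p = "(real n + (s - 1/2) + 1) / T" and ?q = "(real n + (s - 1/2)) / T"
    have nz: "(real n + s)\<^sup>2 + t\<^sup>2 > 0" using assms by (intro add_pos_nonneg) auto
    have "arctan ?p - arctan ?q \<le> (?p - ?q) / (1 + ?p * ?q)"
      using assms T by (intro arctan_diff_le divide_right_mono divide_nonneg_pos) auto
    also have "?p - ?q = 1 / T" by (simp add: diff_divide_distrib[symmetric])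
    also have "1 + ?p * ?q = ((real n + s)\<^sup>2 + t\<^sup>2) / T\<^sup>2"
    proof -
      have "1 + (u + 1) / T * (u / T) = (T\<^sup>2 + (u + 1) * u) / T\<^sup>2" for u
        using T(1) by (simp add: field_simps power2_eq_square)
      then have "1 + ?p * ?q = (T\<^sup>2 + (real n + (s - 1/2) + 1) * (real n + (s - 1/2))) / T\<^sup>2" .
      also have "T\<^sup>2 + (real n + (s - 1/2) + 1) * (real n + (s - 1/2)) = (real n + s)\<^sup>2 + t\<^sup>2"
        unfolding T(2) by (simp add: power2_eq_square algebra_simps)
      finally show ?thesis .
    qed
    also have "1 / T / (((real n + s)\<^sup>2 + t\<^sup>2) / T\<^sup>2) = T * (1 / ((real n + s)\<^sup>2 + t\<^sup>2))"
      using T(1) nz by (simp add: field_simps power2_eq_square)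
    finally show "arctan ?p - arctan ?q \<le> T * (1 / ((real n + s)\<^sup>2 + t\<^sup>2))" .
  next
    show "summable (\<lambda>n. arctan ((real n + (s - 1/2) + 1) / T) - arctan ((real n + (s - 1/2)) / T))"
      using arctan_shift_telescope[OF T(1)] by (rule sums_summable)
    show "summable (\<lambda>n. T * (1 / ((real n + s)\<^sup>2 + t\<^sup>2)))"
      using assms by (intro summable_mult summable_lorentz) auto
  qed
  also have "\<dots> = T * lorentz_sum s t"
    unfolding lorentz_sum_def using assms by (intro suminf_mult summable_lorentz) auto
  finally show ?thesis .
qed

lemma lorentz_sum_antimono:
  assumes "0 < s" "s \<le> s'" "t\<^sup>2 \<le> t'\<^sup>2"
  shows "lorentz_sum s' t' \<le> lorentz_sum s t"
  unfolding lorentz_sum_def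
proof (rule suminf_le)
  fix n
  have "(real n + s)\<^sup>2 \<le> (real n + s')\<^sup>2" using assms by (intro power_mono) auto
  moreover have "(real n + s)\<^sup>2 > 0" using assms by simp
  ultimately show "1 / ((real n + s')\<^sup>2 + t'\<^sup>2) \<le> 1 / ((real n + s)\<^sup>2 + t\<^sup>2)"
    using assms by (intro divide_left_mono mult_pos_pos add_mono add_pos_nonneg) auto
qed (use assms in \<open>auto intro!: summable_lorentz\<close>)

section \<open>The harmonic majorant\<close>

text \<open>Im psi(z + 1/2) - arg z is harmonic. It vanishes on the positive real axis and is
  nonpositive on the positive imaginary axis and on the small arc; only the large arc costs an
  error, at most 1 / R.\<close>

lemma lorentz_sum_le_arctan_half:
  assumes "\<sigma> > 0" "t > 0"
  shows "t * lorentz_sum (\<sigma> + 1/2) t \<le> arctan (t / \<sigma>)"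
proof (rule field_le_epsilon)
  fix \<eta> :: real assume "\<eta> > 0"
  define z0 where "z0 = Complex \<sigma> t"
  define K where "K = lorentz_sum (1/2) 0"
  \<comment> \<open>On the small arc the sum is at most y K \<le> y / \<epsilon> = sin(arg z) \<le>
    arg z, hence the bound 1 / K. The other bound keeps \<open>z0\<close> outside the removed
    disc.\<close>
  define \<epsilon> where "\<epsilon> = min (cmod z0) (1 / K)"
  define R where "R = max (cmod z0) (1 / \<eta>)"
  \<comment> \<open>The disc around 0 is cut out because \<open>Im Ln\<close> is discontinuous at the corner of the quadrant.\<close>
  define S where "S = ({z. 0 \<le> Re z} \<inter> {z. 0 \<le> Im z}) \<inter> (cball 0 R - ball 0 \<epsilon>)"
  have K: "K > 0" unfolding K_def by (rule lorentz_sum_pos) simp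
  have z0: "cmod z0 > 0" using assms by (simp add: z0_def complex_eq_iff)
  have \<epsilon>: "\<epsilon> > 0" "\<epsilon> \<le> 1 / K" "\<epsilon> \<le> cmod z0"
    unfolding \<epsilon>_def using K z0 by simp_all
  have R: "cmod z0 \<le> R" "1 / \<eta> \<le> R" unfolding R_def by simp_all
  have R': "R > 0" using z0 R(1) by linarith
  then have R'': "1 / R \<le> \<eta>"
    using \<open>\<eta> > 0\<close> R(2) by (simp add: field_simps)
  have S: "closed S" "bounded S"
    unfolding S_def
    by (auto intro!: closed_Int closed_halfspace_Re_ge closed_halfspace_Im_ge closed_Diff bounded_Int bounded_diff)
  have SD: "z \<noteq> 0 \<and> 0 \<le> Re z \<and> 0 \<le> Im z \<and> \<epsilon> \<le> cmod z \<and> cmod z \<le> R" if "z \<in> S" for z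
    using that \<epsilon>(1) by (auto simp: S_def)
  \<comment> \<open>The factor \<open>\<i>\<close> turns the difference of imaginary parts into a
    real part, as \<open>max_principle_Re\<close> requires.\<close>
  let ?f = "\<lambda>z. \<i> * (Ln z - Digamma (z + 1/2))"
  have holo: "?f holomorphic_on S"
  proof -
    have "?f field_differentiable (at z within S)" if "z \<in> S" for z
    proof -
      have 1: "z \<notin> \<real>\<^sub>\<le>\<^sub>0" using SD[OF that] by (auto simp: complex_nonpos_Reals_iff complex_eq_iff)
      have 2: "z + 1/2 \<notin> \<int>\<^sub>\<le>\<^sub>0" using SD[OF that] by (intro not_nonpos_Ints) simp
      have "(?f has_field_derivative \<i> * (inverse z - Polygamma 1 (z + 1/2))) (at z within S)"
        using 1 2 by (auto intro!: derivative_eq_intros)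
      then show ?thesis by (auto simp: field_differentiable_def)
    qed
    then show ?thesis by (simp add: holomorphic_on_def)
  qed
  have Re_f: "Re (?f z) = Im z * lorentz_sum (Re z + 1/2) (Im z) - Im (Ln z)" if "z \<in> S" for z
  proof -
    have "z + 1/2 = Complex (Re z + 1/2) (Im z)" by (simp add: complex_eq_iff)
    then show ?thesis using Im_Digamma[of "Re z + 1/2" "Im z"] SD[OF that] by simp
  qed
  have bd: "Re (?f z) \<le> \<eta>" if z: "z \<in> S" and int: "z \<notin> interior S" for z
  proof -
    let ?x = "Re z" and ?y = "Im z"
    note zS = SD[OF z]
    have cases: "?y = 0 \<or> ?x = 0 \<or> cmod z = \<epsilon> \<or> cmod z = R"
    proof (rule ccontr)
      assume "\<not> ?thesis"
      then have "z \<in> ({z. 0 < Re z} \<inter> {z. 0 < Im z}) \<inter> (ball 0 R - cball 0 \<epsilon>)" (is "_ \<in> ?U")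
        using zS by auto
      moreover have "open ?U"
        by (intro open_Int open_halfspace_Re_gt open_halfspace_Im_gt open_Diff) auto
      moreover have "?U \<subseteq> S" by (auto simp: S_def)
      ultimately have "z \<in> interior S" by (meson interiorI)
      with int show False ..
    qed
    have Im_Ln: "Im (Ln z) = (if ?x > 0 then arctan (?y / ?x) else pi / 2)" if "?y > 0"
      using zS that by (auto simp: Im_Ln_eq)
    consider "?y = 0" | "?y > 0" "?x = 0" | "?y > 0" "cmod z = \<epsilon>" | "?y > 0" "cmod z = R"
      using cases zS by (auto simp: less_le)
    then have "?y * lorentz_sum (?x + 1/2) ?y \<le> Im (Ln z) + \<eta>"
    proof cases
      case 1
      then show ?thesis using zS \<open>\<eta> > 0\<close> by (auto simp: Im_Ln_eq complex_eq_iff)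
    next
      case 2
      have "?y * lorentz_sum (1/2) ?y = pi / 2 * tanh (pi * ?y)"
        by (rule lorentz_sum_half) (use 2 in simp)
      also have "\<dots> \<le> pi / 2 * 1" by (intro mult_left_mono) (auto intro: less_imp_le tanh_real_lt_1)
      finally show ?thesis using 2 Im_Ln \<open>\<eta> > 0\<close> by simp
    next
      case 3
      have "?y * lorentz_sum (?x + 1/2) ?y \<le> ?y * K"
        unfolding K_def using 3 zS by (intro mult_left_mono lorentz_sum_antimono) auto
      also have "\<dots> \<le> ?y / \<epsilon>" using mult_left_mono[OF \<epsilon>(2), of ?y] \<epsilon> K 3(1)
        by (simp add: field_simps)
      also have "\<dots> \<le> Im (Ln z)"
      proof -
        have "z = exp (Ln z)" using zS by simp
        then have "?y = exp (Re (Ln z)) * sin (Im (Ln z))" by (metis Im_exp)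
        also have "exp (Re (Ln z)) = cmod z" using zS by (simp)
        also have "sin (Im (Ln z)) \<le> Im (Ln z)"
          using zS Im_Ln_pos_le[of z] by (intro sin_x_le_x) auto
        finally show ?thesis using 3 \<epsilon> by (simp add: field_simps)
      qed
      finally show ?thesis using \<open>\<eta> > 0\<close> by simp
    next
      case 4
      \<comment> \<open>The shift by 1/2 only lowers the arctangent, so the excess over arg z is the
        first term of the telescoping bound, at most 1 / R.\<close>
      have "?y * lorentz_sum (?x + 1/2) ?y \<le> ?y / ((?x + 1/2)\<^sup>2 + ?y\<^sup>2) + arctan (?y / (?x + 1/2))"
        using zS 4 by (intro lorentz_sum_le_arctan) auto
      also have "arctan (?y / (?x + 1/2)) \<le> Im (Ln z)"
      proof (cases "?x > 0")
        case True
        then have "?y / (?x + 1/2) \<le> ?y / ?x" using 4 by (intro divide_left_mono) auto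
        then show ?thesis using True 4 Im_Ln by (simp add: arctan_le_iff)
      next
        case False
        then show ?thesis using 4 Im_Ln arctan_ubound[of "?y / (?x + 1/2)"] by simp
      qed
      also have "?y / ((?x + 1/2)\<^sup>2 + ?y\<^sup>2) \<le> ?y / (?x\<^sup>2 + ?y\<^sup>2)"
        using zS 4 by (intro divide_left_mono add_right_mono power_mono mult_pos_pos add_nonneg_pos) auto
      also have "?x\<^sup>2 + ?y\<^sup>2 = R\<^sup>2" using 4(2) cmod_power2[of z] by simp
      also have "?y / R\<^sup>2 \<le> 1 / R"
        using abs_Im_le_cmod[of z] 4 R' by (simp add: field_simps power2_eq_square)
      finally show ?thesis using R'' by simp
    qed
    then show ?thesis using Re_f[OF z] by simp
  qed
  have z0S: "z0 \<in> S" using assms \<epsilon> R by (auto simp: S_def z0_def)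
  have "Re (?f z0) \<le> \<eta>" using holo S bd z0S by (rule max_principle_Re)
  moreover have "Im (Ln z0) = arctan (t / \<sigma>)"
    using z0 assms by (subst Im_Ln_eq) (auto simp: z0_def)
  ultimately show "t * lorentz_sum (\<sigma> + 1/2) t \<le> arctan (t / \<sigma>) + \<eta>"
    using Re_f[OF z0S] by (simp add: z0_def)
qed

lemma less_tan:
  fixes x :: real
  assumes "0 < x" "x < pi / 2"
  shows "x < tan x"
proof -
  have "\<exists>z>0. z < x \<and> tan x - tan 0 = (x - 0) * inverse ((cos z)\<^sup>2)"
  proof (rule MVT2[OF assms(1)])
    fix y assume "0 \<le> y" "y \<le> x"
    then have "cos y > 0" using assms by (intro cos_gt_zero_pi) auto
    then show "(tan has_real_derivative inverse ((cos y)\<^sup>2)) (at y)" by simp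
  qed
  then obtain z where z: "0 < z" "z < x" "tan x = x * inverse ((cos z)\<^sup>2)" by auto
  have "0 < cos z" "cos z < 1"
    using z assms cos_monotone_0_pi[of 0 z] by (auto intro!: cos_gt_zero)
  then have "inverse ((cos z)\<^sup>2) > 1"
    using power_strict_mono[of "cos z" 1 2] by (intro one_less_inverse) auto
  then show ?thesis using z assms by simp
qed

text \<open>The derivative is 8 cot \<theta> (1 - \<theta> cot \<theta>), positive because \<theta>
  < tan \<theta>, and the value at pi / 2 is pi^2.\<close>

lemma square_add_cot_less:
  fixes \<theta> :: real
  assumes "0 < \<theta>" "\<theta> < pi / 2"
  shows "4 * \<theta>\<^sup>2 + 8 * \<theta> * cot \<theta> < pi\<^sup>2"
proof -
  let ?g = "\<lambda>x::real. 4 * x\<^sup>2 + 8 * x * cot x"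
  have "?g \<theta> < ?g (pi / 2)"
  proof (rule DERIV_pos_imp_increasing_open[OF assms(2)])
    fix x assume x: "\<theta> < x" "x < pi / 2"
    have sc: "sin x > 0" "cos x > 0" using x assms by (auto intro!: sin_gt_zero cos_gt_zero)
    have "sin x \<noteq> 0" using sc by simp
    note DERIV_cot[OF this]
    then have "(?g has_real_derivative (8 * x + 8 * cot x - 8 * x * inverse ((sin x)\<^sup>2))) (at x)"
      by - (rule derivative_eq_intros refl | assumption | simp)+
    moreover have "8 * x + 8 * cot x - 8 * x * inverse ((sin x)\<^sup>2) = 8 * cot x * (1 - x * cot x)"
    proof -
      have "1 + (cot x)\<^sup>2 = ((sin x)\<^sup>2 + (cos x)\<^sup>2) / (sin x)\<^sup>2"
        using sc by (simp add: cot_def power_divide add_divide_distrib del: sin_cos_squared_add)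
      then have "inverse ((sin x)\<^sup>2) = 1 + (cot x)\<^sup>2" by (simp add: inverse_eq_divide)
      then show ?thesis by (simp only:) (simp add: algebra_simps power2_eq_square)
    qed
    moreover have "x * cot x < 1"
      using less_tan[of x] x assms sc by (simp add: tan_def cot_def field_simps)
    moreover have "cot x > 0" using sc by (simp add: cot_def)
    ultimately show "\<exists>y. (?g has_real_derivative y) (at x) \<and> 0 < y"
      by (intro exI[of _ "8 * cot x * (1 - x * cot x)"]) auto
  next
    show "continuous_on {\<theta>..pi / 2} ?g"
      using assms by (intro continuous_intros) (auto intro!: less_imp_neq[THEN not_sym] sin_gt_zero)
  qed
  then show ?thesis by (simp add: power2_eq_square cot_def)
qed

section \<open>Cauchy--Schwarz with Lorentzian weights\<close>

text \<open>With y = t L and cot \<theta> = \<sigma> / t the left side is 4 y^2 + 8 y cot \<theta>,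
  which increases in y, so y \<le> \<theta> reduces it to
  \<open>square_add_cot_less\<close>.\<close>

lemma lorentz_sum_quadratic_less:
  assumes "1/2 < s" "t > 0"
  shows "4 * t\<^sup>2 * (lorentz_sum s t)\<^sup>2 + 4 * (2 * s - 1) * lorentz_sum s t < pi\<^sup>2"
proof -
  define \<sigma> where "\<sigma> = s - 1/2"
  define \<theta> where "\<theta> = arctan (t / \<sigma>)"
  define y where "y = t * lorentz_sum s t"
  have \<sigma>: "\<sigma> > 0" using assms by (simp add: \<sigma>_def)
  have \<theta>: "0 < \<theta>" "\<theta> < pi / 2" using \<sigma> assms arctan_ubound by (auto simp: \<theta>_def)
  have y: "0 < y" using assms lorentz_sum_pos[of s t] by (simp add: y_def)
  have y_le: "y \<le> \<theta>"
    using lorentz_sum_le_arctan_half[OF \<sigma> assms(2)] by (simp add: y_def \<theta>_def \<sigma>_def)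
  have cot: "cot \<theta> = \<sigma> / t"
    using \<sigma> assms tan_arctan[of "t / \<sigma>"] by (simp add: \<theta>_def cot_altdef)
  have "4 * t\<^sup>2 * (lorentz_sum s t)\<^sup>2 + 4 * (2 * s - 1) * lorentz_sum s t = 4 * y\<^sup>2 + 8 * y * cot \<theta>"
    unfolding cot using assms by (simp add: y_def \<sigma>_def power_mult_distrib field_simps)
  also have "\<dots> \<le> 4 * \<theta>\<^sup>2 + 8 * \<theta> * cot \<theta>"
    using y y_le \<sigma> assms by (intro add_mono mult_left_mono mult_right_mono power_mono) (auto simp: cot)
  also have "\<dots> < pi\<^sup>2" by (rule square_add_cot_less[OF \<theta>])
  finally show ?thesis .
qed

lemma admissibleD:
  fixes s t :: real
  assumes adm: "admissible (1 - s) a" and "s > 0" "t > 0"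
  shows "summable (\<lambda>n. (a n)\<^sup>2)" "summable (\<lambda>n. ((real n + s) * a n)\<^sup>2)"
    "sq_sum a = (\<Sum>n. (a n)\<^sup>2)" "wsq_sum (1 - s) a = (\<Sum>n. ((real n + s) * a n)\<^sup>2)"
    "summable (\<lambda>n. \<bar>a n\<bar>)" "summable a"
    "(\<lambda>n. ((real n + s)\<^sup>2 + t\<^sup>2) * (a n)\<^sup>2) sums (wsq_sum (1 - s) a + t\<^sup>2 * sq_sum a)"
proof -
  have eq: "real (Suc n) - (1 - s) = real n + s" for n by simp
  show A: "summable (\<lambda>n. (a n)\<^sup>2)" and B: "summable (\<lambda>n. ((real n + s) * a n)\<^sup>2)"
    using adm unfolding admissible_def eq by auto
  show A': "sq_sum a = (\<Sum>n. (a n)\<^sup>2)" and B': "wsq_sum (1 - s) a = (\<Sum>n. ((real n + s) * a n)\<^sup>2)"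
    unfolding sq_sum_def wsq_sum_def eq by auto
  have "(\<lambda>n. ((real n + s) * a n)\<^sup>2 + t\<^sup>2 * (a n)\<^sup>2) sums (wsq_sum (1 - s) a + t\<^sup>2 * sq_sum a)"
    unfolding A' B' by (intro sums_add sums_mult summable_sums A B)
  moreover have "(x * y)\<^sup>2 + t\<^sup>2 * y\<^sup>2 = (x\<^sup>2 + t\<^sup>2) * y\<^sup>2" for x y :: real
    by (simp add: power_mult_distrib distrib_right)
  ultimately show w: "(\<lambda>n. ((real n + s)\<^sup>2 + t\<^sup>2) * (a n)\<^sup>2) sums (wsq_sum (1 - s) a + t\<^sup>2 * sq_sum a)"
    by (simp only:)
  \<comment> \<open>Admissibility only controls squares, while \<open>suminf a\<close> means the sum
    only for summable \<open>a\<close>. Summability follows from |x| \<le> w x^2 + 1 / w with the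
    Lorentzian weights w.\<close>
  show "summable (\<lambda>n. \<bar>a n\<bar>)"
  proof (rule summable_comparison_test')
    show "summable (\<lambda>n. ((real n + s)\<^sup>2 + t\<^sup>2) * (a n)\<^sup>2 + 1 / ((real n + s)\<^sup>2 + t\<^sup>2))"
      using w assms by (intro summable_add summable_lorentz) (auto simp: sums_iff)
    fix n
    define w where "w = (real n + s)\<^sup>2 + t\<^sup>2"
    have w: "w > 0" using assms by (auto simp: w_def intro!: add_pos_nonneg)
    have "0 \<le> (w * \<bar>a n\<bar> - 1)\<^sup>2 + w * \<bar>a n\<bar>" using w by simp
    also have "\<dots> = w * (w * (a n)\<^sup>2 + 1 / w - \<bar>a n\<bar>)"
      using w by (simp add: power2_eq_square algebra_simps)
    finally have "\<bar>a n\<bar> \<le> w * (a n)\<^sup>2 + 1 / w" using w by (simp add: zero_le_mult_iff)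
    then show "norm \<bar>a n\<bar> \<le> ((real n + s)\<^sup>2 + t\<^sup>2) * (a n)\<^sup>2 + 1 / ((real n + s)\<^sup>2 + t\<^sup>2)"
      by (simp add: w_def)
  qed
  then show "summable a" by (rule summable_rabs_cancel)
qed

text \<open>Completing the square makes the gap in Cauchy-Schwarz an explicit sum of nonnegative
  terms. The inequality and its equality case can both be read off; \<open>c\<close> is the
  coefficient of the projection of \<open>a\<close> onto the Lorentzian sequence.\<close>

lemma cauchy_schwarz_defect:
  fixes s t :: real
  assumes adm: "admissible (1 - s) a" and "s > 0" "t > 0"
  defines "c \<equiv> suminf a / lorentz_sum s t"
  shows "(\<lambda>n. ((real n + s)\<^sup>2 + t\<^sup>2) * (a n - c / ((real n + s)\<^sup>2 + t\<^sup>2))\<^sup>2) sums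
    (wsq_sum (1 - s) a + t\<^sup>2 * sq_sum a - (suminf a)\<^sup>2 / lorentz_sum s t)"
proof -
  note facts = admissibleD[OF assms(1-3)]
  let ?L = "lorentz_sum s t"
  have L: "?L > 0" using assms by (intro lorentz_sum_pos)
  have "(\<lambda>n. 1 / ((real n + s)\<^sup>2 + t\<^sup>2)) sums ?L"
    unfolding lorentz_sum_def by (intro summable_sums summable_lorentz assms)
  moreover have "a sums suminf a" by (intro summable_sums facts)
  ultimately have "(\<lambda>n. ((real n + s)\<^sup>2 + t\<^sup>2) * (a n)\<^sup>2 - 2 * c * a n + c\<^sup>2 * (1 / ((real n + s)\<^sup>2 + t\<^sup>2))) sums
      (wsq_sum (1 - s) a + t\<^sup>2 * sq_sum a - 2 * c * suminf a + c\<^sup>2 * ?L)"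
    by (intro sums_add sums_diff sums_mult facts)
  also have "2 * c * suminf a = 2 * ((suminf a)\<^sup>2 / ?L)" by (simp add: c_def power2_eq_square)
  also have "c\<^sup>2 * ?L = (suminf a)\<^sup>2 / ?L" using L by (simp add: c_def power2_eq_square)
  also have "(\<lambda>n. ((real n + s)\<^sup>2 + t\<^sup>2) * (a n)\<^sup>2 - 2 * c * a n + c\<^sup>2 * (1 / ((real n + s)\<^sup>2 + t\<^sup>2))) =
      (\<lambda>n. ((real n + s)\<^sup>2 + t\<^sup>2) * (a n - c / ((real n + s)\<^sup>2 + t\<^sup>2))\<^sup>2)"
  proof
    fix n
    have "w * x\<^sup>2 - 2 * c * x + c\<^sup>2 * (1 / w) = w * (x - c / w)\<^sup>2" if "w > 0" for w x :: real
      using that by (simp add: power2_eq_square field_simps)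
    moreover have "(real n + s)\<^sup>2 + t\<^sup>2 > 0" using assms by (auto intro!: add_pos_nonneg)
    ultimately show "((real n + s)\<^sup>2 + t\<^sup>2) * (a n)\<^sup>2 - 2 * c * a n + c\<^sup>2 * (1 / ((real n + s)\<^sup>2 + t\<^sup>2)) =
      ((real n + s)\<^sup>2 + t\<^sup>2) * (a n - c / ((real n + s)\<^sup>2 + t\<^sup>2))\<^sup>2" by blast
  qed
  finally show ?thesis by simp
qed

lemma suminf_square_le:
  assumes "admissible (1 - s) a" "s > 0" "t > 0"
  shows "(suminf a)\<^sup>2 \<le> (wsq_sum (1 - s) a + t\<^sup>2 * sq_sum a) * lorentz_sum s t"
proof -
  have "0 \<le> wsq_sum (1 - s) a + t\<^sup>2 * sq_sum a - (suminf a)\<^sup>2 / lorentz_sum s t"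
    by (rule sums_le[OF _ sums_zero cauchy_schwarz_defect[OF assms]]) (auto intro!: mult_nonneg_nonneg)
  then show ?thesis using lorentz_sum_pos[OF assms(2), of t] by (simp add: field_simps)
qed

lemma suminf_square_eqD:
  assumes "admissible (1 - s) a" "s > 0" "t > 0"
    and eq: "(suminf a)\<^sup>2 = (wsq_sum (1 - s) a + t\<^sup>2 * sq_sum a) * lorentz_sum s t"
  shows "a n = suminf a / lorentz_sum s t * (1 / ((real n + s)\<^sup>2 + t\<^sup>2))"
proof -
  have "wsq_sum (1 - s) a + t\<^sup>2 * sq_sum a - (suminf a)\<^sup>2 / lorentz_sum s t = 0"
    unfolding eq using lorentz_sum_pos[OF assms(2), of t] by simp
  with cauchy_schwarz_defect[OF assms(1-3)]
  have "(\<lambda>n. ((real n + s)\<^sup>2 + t\<^sup>2) *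
      (a n - suminf a / lorentz_sum s t / ((real n + s)\<^sup>2 + t\<^sup>2))\<^sup>2) sums 0" by simp
  moreover have "0 \<le> ((real n + s)\<^sup>2 + t\<^sup>2) *
      (a n - suminf a / lorentz_sum s t / ((real n + s)\<^sup>2 + t\<^sup>2))\<^sup>2" for n by simp
  ultimately have "((real n + s)\<^sup>2 + t\<^sup>2) * (a n - suminf a / lorentz_sum s t / ((real n + s)\<^sup>2 + t\<^sup>2))\<^sup>2 = 0"
    unfolding sums_iff using suminf_eq_zero_iff by blast
  moreover have "(real n + s)\<^sup>2 + t\<^sup>2 \<noteq> 0" using assms by (simp add: sum_power2_eq_zero_iff)
  ultimately show ?thesis by auto
qed

lemma sq_sum_bounds:
  assumes adm: "admissible (1 - s) a" and "s > 0"
  shows "0 \<le> sq_sum a" "s\<^sup>2 * sq_sum a \<le> wsq_sum (1 - s) a"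
    "a n \<noteq> 0 \<Longrightarrow> 0 < sq_sum a" "a n \<noteq> 0 \<Longrightarrow> 0 < wsq_sum (1 - s) a"
proof -
  note facts = admissibleD[OF adm \<open>s > 0\<close> zero_less_one]
  show "0 \<le> sq_sum a" unfolding facts(3) by (intro suminf_nonneg facts) auto
  have "s\<^sup>2 * sq_sum a = (\<Sum>n. s\<^sup>2 * (a n)\<^sup>2)"
    unfolding facts(3) by (rule suminf_mult[OF facts(1), symmetric])
  also have "\<dots> \<le> wsq_sum (1 - s) a"
    unfolding facts(4)
  proof (intro suminf_le summable_mult facts)
    fix n
    have "s\<^sup>2 \<le> (real n + s)\<^sup>2" using assms by (intro power_mono) auto
    then show "s\<^sup>2 * (a n)\<^sup>2 \<le> ((real n + s) * a n)\<^sup>2"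
      unfolding power_mult_distrib by (intro mult_right_mono) auto
  qed
  finally show *: "s\<^sup>2 * sq_sum a \<le> wsq_sum (1 - s) a" .
  assume nz: "a n \<noteq> 0"
  show A: "0 < sq_sum a" unfolding facts(3) by (rule suminf_pos2[OF facts(1), of n]) (use nz in auto)
  have "0 < s\<^sup>2 * sq_sum a" using A assms by simp
  then show "0 < wsq_sum (1 - s) a" using * by simp
qed

lemma admissible_lorentz:
  assumes "s > 0"
  shows "admissible (1 - s) (\<lambda>n. 1 / ((real n + s)\<^sup>2 + t\<^sup>2))"
proof -
  have sm: "summable (\<lambda>n. 1 / ((real n + s)\<^sup>2 + t\<^sup>2))"
    using assms by (rule summable_lorentz)
  from summable_mult[OF sm, of "1 / s\<^sup>2"] have "summable (\<lambda>n. (1 / ((real n + s)\<^sup>2 + t\<^sup>2))\<^sup>2)"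
  proof (rule summable_comparison_test')
    fix n :: nat
    have "s\<^sup>2 \<le> (real n + s)\<^sup>2" using assms by (intro power_mono) auto
    then have "s\<^sup>2 \<le> (real n + s)\<^sup>2 + t\<^sup>2" "(real n + s)\<^sup>2 + t\<^sup>2 > 0"
      using assms by (auto intro!: add_increasing2 add_pos_nonneg)
    then have "1 / ((real n + s)\<^sup>2 + t\<^sup>2) \<le> 1 / s\<^sup>2"
      using assms by (intro divide_left_mono mult_pos_pos) auto
    then have "1 / ((real n + s)\<^sup>2 + t\<^sup>2) * (1 / ((real n + s)\<^sup>2 + t\<^sup>2)) \<le> 1 / s\<^sup>2 * (1 / ((real n + s)\<^sup>2 + t\<^sup>2))"
      by (intro mult_right_mono) auto
    moreover have "norm (x\<^sup>2) = x * x" for x :: real by (simp add: power2_eq_square)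
    ultimately show "norm ((1 / ((real n + s)\<^sup>2 + t\<^sup>2))\<^sup>2) \<le> 1 / s\<^sup>2 * (1 / ((real n + s)\<^sup>2 + t\<^sup>2))"
      by (simp only:)
  qed
  moreover from sm have "summable (\<lambda>n. ((real n + s) * (1 / ((real n + s)\<^sup>2 + t\<^sup>2)))\<^sup>2)"
  proof (rule summable_comparison_test')
    fix n
    have w: "(real n + s)\<^sup>2 + t\<^sup>2 > 0" using assms by (auto intro!: add_pos_nonneg)
    have "(real n + s)\<^sup>2 / ((real n + s)\<^sup>2 + t\<^sup>2) \<le> 1" using w by (simp add: divide_le_eq)
    then have "(real n + s)\<^sup>2 / ((real n + s)\<^sup>2 + t\<^sup>2) * (1 / ((real n + s)\<^sup>2 + t\<^sup>2)) \<le> 1 * (1 / ((real n + s)\<^sup>2 + t\<^sup>2))"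
      using w by (intro mult_right_mono) auto
    then show "norm (((real n + s) * (1 / ((real n + s)\<^sup>2 + t\<^sup>2)))\<^sup>2) \<le> 1 / ((real n + s)\<^sup>2 + t\<^sup>2)"
      by (simp add: power_mult_distrib power_divide power2_eq_square[of "_ + _"])
  qed
  ultimately show ?thesis by (simp add: admissible_def)
qed

text \<open>Weight times e^2 is e again, so sum and weighted energy coincide and \<open>e\<close>
  attains equality in \<open>suminf_square_le\<close> for this t.\<close>

lemma lorentz_energy:
  assumes "s > 0" "t > 0"
  defines "e \<equiv> \<lambda>n. 1 / ((real n + s)\<^sup>2 + t\<^sup>2)"
  shows "suminf e = lorentz_sum s t" "wsq_sum (1 - s) e + t\<^sup>2 * sq_sum e = lorentz_sum s t"
proof -
  show "suminf e = lorentz_sum s t" by (simp add: e_def lorentz_sum_def)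
  have "(\<lambda>n. ((real n + s)\<^sup>2 + t\<^sup>2) * (e n)\<^sup>2) sums (wsq_sum (1 - s) e + t\<^sup>2 * sq_sum e)"
    unfolding e_def using assms by (intro admissibleD(7) admissible_lorentz)
  also have "(\<lambda>n. ((real n + s)\<^sup>2 + t\<^sup>2) * (e n)\<^sup>2) = e"
  proof
    fix n
    have "(real n + s)\<^sup>2 + t\<^sup>2 \<noteq> 0" using assms by (simp add: sum_power2_eq_zero_iff)
    then show "((real n + s)\<^sup>2 + t\<^sup>2) * (e n)\<^sup>2 = e n" by (simp add: e_def power2_eq_square[of "1 / _"])
  qed
  finally show "wsq_sum (1 - s) e + t\<^sup>2 * sq_sum e = lorentz_sum s t"
    unfolding sums_iff by (simp add: e_def lorentz_sum_def)
qed

section \<open>The inequality with a defect term\<close>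

lemma sqrt_mult_eq_mult_sqrt_divide:
  fixes A B :: real
  assumes "A > 0" "B \<ge> 0"
  shows "sqrt A * sqrt B = A * sqrt (B / A)"
proof -
  have "sqrt (B / A) = sqrt B / sqrt A" by (rule real_sqrt_divide)
  then have "A * sqrt (B / A) = (sqrt A * sqrt A) * (sqrt B / sqrt A)" using assms by simp
  also have "\<dots> = sqrt A * sqrt B" using assms by (simp add: field_simps)
  finally show ?thesis by simp
qed

text \<open>Strictness for every nonzero sequence is inherited from
  \<open>lorentz_sum_quadratic_less\<close>; it yields the absence of extremals.\<close>

lemma defect_inequality_strict:
  assumes "1/2 < s" "s \<le> 1" and adm: "admissible (1 - s) a" and nz: "a n \<noteq> 0"
  shows "(suminf a)\<^sup>2 < pi * sqrt (sq_sum a) * sqrt (wsq_sum (1 - s) a) - (2 * s - 1) * sq_sum a"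
proof -
  define A where "A = sq_sum a"
  define B where "B = wsq_sum (1 - s) a"
  define c where "c = 2 * s - 1"
  define r where "r = sqrt (B / A)"
  have s: "s > 0" using assms by simp
  have A: "A > 0" and B: "B > 0" and AB: "s\<^sup>2 * A \<le> B"
    unfolding A_def B_def using sq_sum_bounds[OF adm s] nz by auto
  have "s\<^sup>2 \<le> B / A" using AB A by (simp add: field_simps)
  then have r: "s \<le> r" "r > 0" using s unfolding r_def by (auto intro: real_le_rsqrt simp: A B)
  have r2: "B = r\<^sup>2 * A" unfolding r_def using A B by simp
  \<comment> \<open>Together with s \<le> r this makes r^2 - 2 c r / pi positive, so that its square
    root t is a valid parameter.\<close>
  have c: "0 < c" "2 * c < pi * s"
  proof -
    show "0 < c" using assms by (simp add: c_def)
    have "2 * c < 3 * s" using assms by (simp add: c_def)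
    also have "\<dots> < pi * s" using s pi_gt3 by simp
    finally show "2 * c < pi * s" .
  qed
  \<comment> \<open>Here \<open>r\<close> makes AM-GM sharp in \<open>pi sqrt(A B) = pi (r A + B / r) / 2\<close>, and then
    \<open>pi (r + x^2 / r) / 2 - c = pi / (2 r) * (x^2 + t^2)\<close> for this \<open>t\<close>.\<close>
  define t where "t = sqrt (r\<^sup>2 - 2 * c * r / pi)"
  have rc: "pi * r - 2 * c > 0" proof -
    have "pi * s \<le> pi * r" using r(1) by simp
    with c(2) show ?thesis by linarith
  qed
  have t2: "t\<^sup>2 = r * (pi * r - 2 * c) / pi" and t: "t > 0"
  proof -
    have *: "r\<^sup>2 - 2 * c * r / pi = r * (pi * r - 2 * c) / pi" by (simp add: field_simps power2_eq_square)
    have "\<dots> > 0" using rc r by simp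
    then show "t\<^sup>2 = r * (pi * r - 2 * c) / pi" "t > 0" unfolding t_def * by auto
  qed
  define L where "L = lorentz_sum s t"
  have L: "L > 0" unfolding L_def using s by (rule lorentz_sum_pos)
  have "4 * t\<^sup>2 * L\<^sup>2 + 4 * c * L < pi\<^sup>2"
    unfolding L_def c_def using assms(1) t by (rule lorentz_sum_quadratic_less)
  \<comment> \<open>Under the link between t and r the quadratic condition factors. The second
    factor is positive, so only 2 r L < pi remains.\<close>
  moreover have "pi * (4 * t\<^sup>2 * L\<^sup>2 + 4 * c * L - pi\<^sup>2) =
      (2 * r * L - pi) * (2 * L * (pi * r - 2 * c) + pi\<^sup>2)"
    unfolding t2 by (simp add: field_simps power2_eq_square)
  ultimately have "(2 * r * L - pi) * (2 * L * (pi * r - 2 * c) + pi\<^sup>2) < 0"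
    by (metis diff_less_0_iff_less mult_pos_neg pi_gt_zero)
  moreover have "2 * L * (pi * r - 2 * c) + pi\<^sup>2 > 0" using rc L by (intro add_pos_pos mult_pos_pos) auto
  ultimately have rL: "2 * r * L < pi" by (simp add: mult_less_0_iff)
  have "(suminf a)\<^sup>2 \<le> (B + t\<^sup>2 * A) * L"
    unfolding A_def B_def L_def by (rule suminf_square_le[OF adm s t])
  also have "\<dots> = A * (2 * r * L) * (pi * r - c) / pi"
    unfolding r2 t2 by (simp add: field_simps power2_eq_square)
  also have "\<dots> < A * pi * (pi * r - c) / pi"
    using A rL rc c by (intro divide_strict_right_mono mult_strict_right_mono mult_strict_left_mono) auto
  also have "\<dots> = pi * (A * r) - c * A" by (simp add: field_simps)
  also have "A * r = sqrt A * sqrt B" unfolding r_def using A B by (intro sqrt_mult_eq_mult_sqrt_divide[symmetric]) auto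
  finally show ?thesis by (simp add: A_def B_def c_def mult.assoc)
qed

section \<open>Sharpness of the constants pi and 2 s - 1\<close>

lemma lorentz_sum_quadratic_eventually_gt:
  assumes "1/2 < s" "\<gamma> > 2 * s - 1"
  shows "\<exists>t>0. 4 * t\<^sup>2 * (lorentz_sum s t)\<^sup>2 + 4 * \<gamma> * lorentz_sum s t > pi\<^sup>2"
proof -
  let ?c = "2 * s - 1"
  have "\<forall>\<^sub>F T in at_top. 4 * (T\<^sup>2 - 1/4) * ((pi / 2 - (?c / 2) / T) / T)\<^sup>2 + 4 * \<gamma> * ((pi / 2 - (?c / 2) / T) / T) > pi\<^sup>2"
  proof -
    \<comment> \<open>Here L is replaced by the lower bound from
      \<open>lorentz_sum_ge_arctan\<close> with arctan x \<le> x. The constant pi^2 cancels, and the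
      coefficient of 1 / T is positive exactly for \<gamma> > 2 s - 1.\<close>
    have "((\<lambda>T. T * (4 * (T\<^sup>2 - 1/4) * ((pi / 2 - (?c / 2) / T) / T)\<^sup>2 + 4 * \<gamma> * ((pi / 2 - (?c / 2) / T) / T) - pi\<^sup>2))
       \<longlongrightarrow> 2 * pi * (\<gamma> - ?c)) at_top"
      by (real_asymp simp: power2_eq_square algebra_simps) (simp add: field_simps)
    moreover have "2 * pi * (\<gamma> - ?c) > 0" using assms by simp
    ultimately have "\<forall>\<^sub>F T in at_top. T * (4 * (T\<^sup>2 - 1/4) * ((pi / 2 - (?c / 2) / T) / T)\<^sup>2 + 4 * \<gamma> * ((pi / 2 - (?c / 2) / T) / T) - pi\<^sup>2) > 0"
      by (rule order_tendstoD)
    then show ?thesis using eventually_gt_at_top[of 0]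
      by eventually_elim (simp add: zero_less_mult_iff)
  qed
  moreover have "\<forall>\<^sub>F T in at_top. pi / 2 - (?c / 2) / T > 0" by real_asymp
  ultimately have "\<forall>\<^sub>F T in at_top. T > 1 \<and> pi / 2 - (?c / 2) / T > 0 \<and>
      4 * (T\<^sup>2 - 1/4) * ((pi / 2 - (?c / 2) / T) / T)\<^sup>2 + 4 * \<gamma> * ((pi / 2 - (?c / 2) / T) / T) > pi\<^sup>2"
    using eventually_gt_at_top[of 1] by eventually_elim auto
  then obtain T where T: "T > 1" "pi / 2 - (?c / 2) / T > 0"
    "4 * (T\<^sup>2 - 1/4) * ((pi / 2 - (?c / 2) / T) / T)\<^sup>2 + 4 * \<gamma> * ((pi / 2 - (?c / 2) / T) / T) > pi\<^sup>2"
    by (auto simp: eventually_at_top_linorder)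
  define t where "t = sqrt (T\<^sup>2 - 1/4)"
  define y where "y = (pi / 2 - (?c / 2) / T) / T"
  have "T\<^sup>2 > 1\<^sup>2" using T(1) by (intro power_strict_mono) auto
  then have t: "t > 0" "t\<^sup>2 = T\<^sup>2 - 1/4" by (auto simp: t_def)
  have Tt: "sqrt (t\<^sup>2 + 1/4) = T" using t T(1) by simp
  have "arctan ((s - 1/2) / T) \<le> (s - 1/2) / T"
    using assms T(1) by (intro arctan_le_self) auto
  also have "\<dots> = (?c / 2) / T" by (simp add: field_simps)
  finally have "pi / 2 - (?c / 2) / T \<le> T * lorentz_sum s t"
    using lorentz_sum_ge_arctan[of s t] assms unfolding Tt by linarith
  then have yL: "y \<le> lorentz_sum s t" unfolding y_def using T(1) by (simp add: field_simps)
  have y: "y > 0" unfolding y_def using T by simp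
  have "pi\<^sup>2 < 4 * t\<^sup>2 * y\<^sup>2 + 4 * \<gamma> * y" using T(3) unfolding t(2) y_def .
  also have "\<dots> \<le> 4 * t\<^sup>2 * (lorentz_sum s t)\<^sup>2 + 4 * \<gamma> * lorentz_sum s t"
    using y yL assms by (intro add_mono mult_left_mono power_mono) auto
  finally show ?thesis using t by blast
qed

text \<open>A Lorentzian sequence is extremal in Cauchy-Schwarz at its own t, so the argument for
  the defect inequality can be run backwards on it, at a t where the quadratic expression exceeds
  pi^2.\<close>

lemma defect_constant_sharp:
  assumes "1/2 < s" "\<gamma> > 2 * s - 1"
  shows "\<exists>a. admissible (1 - s) a \<and>
    (suminf a)\<^sup>2 > pi * sqrt (sq_sum a) * sqrt (wsq_sum (1 - s) a) - \<gamma> * sq_sum a \<and> sq_sum a > 0"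
proof -
  obtain t where t: "t > 0" and gt: "4 * t\<^sup>2 * (lorentz_sum s t)\<^sup>2 + 4 * \<gamma> * lorentz_sum s t > pi\<^sup>2"
    using lorentz_sum_quadratic_eventually_gt[OF assms] by blast
  define e where "e = (\<lambda>n. 1 / ((real n + s)\<^sup>2 + t\<^sup>2))"
  define L where "L = lorentz_sum s t"
  define A where "A = sq_sum e"
  define B where "B = wsq_sum (1 - s) e"
  \<comment> \<open>The positive root of r^2 - 2 \<gamma> r / pi = t^2: the link between t and r,
    now solved for r, with \<gamma> as defect constant.\<close>
  define r where "r = \<gamma> / pi + sqrt (t\<^sup>2 + (\<gamma> / pi)\<^sup>2)"
  have s: "s > 0" and \<gamma>: "\<gamma> > 0" using assms by simp_all
  have adm: "admissible (1 - s) e" unfolding e_def using s by (rule admissible_lorentz)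
  have "e 0 \<noteq> 0" using s by (simp add: e_def sum_power2_eq_zero_iff)
  then have A: "A > 0" and B: "B > 0" unfolding A_def B_def using sq_sum_bounds[OF adm s] by auto
  have L: "L > 0" unfolding L_def using s by (rule lorentz_sum_pos)
  have S: "suminf e = L" and E: "B + t\<^sup>2 * A = L"
    using lorentz_energy[OF s t] by (simp_all add: e_def L_def A_def B_def)
  have rgt: "r > \<gamma> / pi + \<gamma> / pi"
  proof -
    have "(\<gamma> / pi)\<^sup>2 < t\<^sup>2 + (\<gamma> / pi)\<^sup>2" using t by simp
    then have "\<gamma> / pi < sqrt (t\<^sup>2 + (\<gamma> / pi)\<^sup>2)" by (rule real_less_rsqrt)
    then show ?thesis by (simp add: r_def)
  qed
  then have rc: "pi * r - 2 * \<gamma> > 0" by (simp add: field_simps)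
  have r: "r > 0" using rgt \<gamma> by (smt (verit) divide_pos_pos pi_gt_zero)
  have "(r - \<gamma> / pi)\<^sup>2 = t\<^sup>2 + (\<gamma> / pi)\<^sup>2" by (simp add: r_def)
  then have "t\<^sup>2 = r\<^sup>2 - 2 * \<gamma> * r / pi" by (simp add: power2_eq_square algebra_simps)
  then have t2: "t\<^sup>2 = r * (pi * r - 2 * \<gamma>) / pi" by (simp add: field_simps power2_eq_square)
  have "pi * (4 * t\<^sup>2 * L\<^sup>2 + 4 * \<gamma> * L - pi\<^sup>2) =
      (2 * r * L - pi) * (2 * L * (pi * r - 2 * \<gamma>) + pi\<^sup>2)"
    unfolding t2 by (simp add: field_simps power2_eq_square)
  moreover have "pi * (4 * t\<^sup>2 * L\<^sup>2 + 4 * \<gamma> * L - pi\<^sup>2) > 0"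
    using gt unfolding L_def by (intro mult_pos_pos) auto
  moreover have "2 * L * (pi * r - 2 * \<gamma>) + pi\<^sup>2 > 0" using rc L by (intro add_pos_pos mult_pos_pos) auto
  ultimately have rL: "pi < 2 * r * L" by (simp add: zero_less_mult_iff)
  \<comment> \<open>Only an upper bound for sqrt(A B) is needed, so AM-GM serves with this r even if
    it differs from sqrt(B / A).\<close>
  have "2 * r * (sqrt A * sqrt B) \<le> r\<^sup>2 * A + B"
  proof -
    have "0 \<le> (r * sqrt A - sqrt B)\<^sup>2" by simp
    also have "\<dots> = r\<^sup>2 * A + B - 2 * r * (sqrt A * sqrt B)"
      using A B by (simp add: power2_diff power_mult_distrib)
    finally show ?thesis by simp
  qed
  also have "\<dots> = L + 2 * \<gamma> * r / pi * A"
    using E unfolding t2 by (simp add: field_simps power2_eq_square)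
  finally have "sqrt A * sqrt B \<le> L / (2 * r) + \<gamma> * A / pi"
    using r by (simp add: field_simps)
  then have "pi * (sqrt A * sqrt B) \<le> pi * L / (2 * r) + \<gamma> * A"
    by (simp add: field_simps)
  moreover have "pi * L / (2 * r) < L\<^sup>2" using rL r L by (simp add: field_simps power2_eq_square)
  ultimately have "L\<^sup>2 > pi * sqrt A * sqrt B - \<gamma> * A" by (simp add: mult.assoc)
  then show ?thesis using adm A S unfolding A_def B_def by blast
qed

text \<open>Since sqrt B \<ge> s sqrt A, lowering pi to C reduces the right side at least as much as
  raising the defect constant by (pi - C) s, and that already fails.\<close>

lemma leading_constant_sharp:
  assumes "1/2 < s" "C < pi"
  shows "\<exists>a. admissible (1 - s) a \<and>
    (suminf a)\<^sup>2 > C * sqrt (sq_sum a) * sqrt (wsq_sum (1 - s) a) - (2 * s - 1) * sq_sum a"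
proof -
  have s: "s > 0" using assms by simp
  have "2 * s - 1 + (pi - C) * s > 2 * s - 1" using assms s by simp
  from defect_constant_sharp[OF assms(1) this] obtain a where adm: "admissible (1 - s) a"
    and gt: "(suminf a)\<^sup>2 > pi * sqrt (sq_sum a) * sqrt (wsq_sum (1 - s) a) - (2 * s - 1 + (pi - C) * s) * sq_sum a"
    and A: "sq_sum a > 0" by blast
  let ?A = "sq_sum a" and ?B = "wsq_sum (1 - s) a"
  have "s * sqrt ?A = sqrt (s\<^sup>2 * ?A)" using s by (simp add: real_sqrt_mult)
  also have "\<dots> \<le> sqrt ?B" using sq_sum_bounds(2)[OF adm s] by simp
  finally have "sqrt ?A * (s * sqrt ?A) \<le> sqrt ?A * sqrt ?B" using A by (intro mult_left_mono) auto
  then have "s * ?A \<le> sqrt ?A * sqrt ?B" using A by (simp add: mult.left_commute)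
  then have "(pi - C) * (s * ?A) \<le> (pi - C) * (sqrt ?A * sqrt ?B)"
    using assms by (intro mult_left_mono) auto
  then have "C * sqrt ?A * sqrt ?B - (2 * s - 1) * ?A \<le>
      pi * sqrt ?A * sqrt ?B - (2 * s - 1 + (pi - C) * s) * ?A"
    by (simp add: algebra_simps)
  then show ?thesis using gt adm by (intro exI[of _ a]) linarith
qed

section \<open>The trigamma function\<close>

lemma Trigamma_sums:
  fixes z :: complex
  assumes "z \<noteq> 0"
  shows "(\<lambda>k. inverse ((z + of_nat k)\<^sup>2)) sums Polygamma 1 z"
  using Polygamma_LIMSEQ[OF assms, of 1] by (simp add: numeral_2_eq_2)

lemma Trigamma_cnj: "Polygamma 1 (cnj z) = cnj (Polygamma 1 z)" if "z \<noteq> 0"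
proof -
  have "(\<lambda>k. inverse ((cnj z + of_nat k)\<^sup>2)) sums cnj (Polygamma 1 z)"
    using Trigamma_sums[OF that] by (subst (asm) sums_cnj[symmetric]) simp
  moreover have "(\<lambda>k. inverse ((cnj z + of_nat k)\<^sup>2)) sums Polygamma 1 (cnj z)"
    using that by (intro Trigamma_sums) simp
  ultimately show ?thesis by (rule sums_unique2[symmetric])
qed

text \<open>For Re w \<ge> 0 one has |k + 1/2 + w|^2 \<ge> (k + 1/2)^2 + |w|^2, so the series is
  dominated by the closed form of \<open>lorentz_sum_half\<close>. This is the decay at infinity
  that the half-plane argument needs.\<close>

lemma norm_Trigamma_le:
  assumes "Re w \<ge> 0" "w \<noteq> 0"
  shows "cmod (Polygamma 1 (1/2 + w)) \<le> pi / (2 * cmod w)"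
proof -
  let ?z = "1/2 + w"
  have z: "?z \<noteq> 0" using assms by (auto simp: complex_eq_iff)
  have bd: "norm (inverse ((?z + of_nat k)\<^sup>2)) \<le> 1 / ((real k + 1/2)\<^sup>2 + (cmod w)\<^sup>2)" for k
  proof -
    have "(cmod (?z + of_nat k))\<^sup>2 = (real k + 1/2)\<^sup>2 + (cmod w)\<^sup>2 + 2 * (real k + 1/2) * Re w"
      unfolding cmod_power2 by (simp add: power2_eq_square algebra_simps)
    then have ge: "(real k + 1/2)\<^sup>2 + (cmod w)\<^sup>2 \<le> (cmod (?z + of_nat k))\<^sup>2" using assms by simp
    have "(real k + 1/2)\<^sup>2 + (cmod w)\<^sup>2 > 0" by (auto intro!: add_pos_nonneg)
    then have "1 / (cmod (?z + of_nat k))\<^sup>2 \<le> 1 / ((real k + 1/2)\<^sup>2 + (cmod w)\<^sup>2)" using ge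
      by (intro divide_left_mono mult_pos_pos) auto
    then show ?thesis by (simp only: norm_inverse norm_power) (simp add: inverse_eq_divide)
  qed
  have sm: "summable (\<lambda>k. 1 / ((real k + 1/2)\<^sup>2 + (cmod w)\<^sup>2))" by (rule summable_lorentz) simp
  have "cmod (Polygamma 1 ?z) = cmod (\<Sum>k. inverse ((?z + of_nat k)\<^sup>2))"
    using sums_unique[OF Trigamma_sums[OF z]] by simp
  also have "\<dots> \<le> lorentz_sum (1/2) (cmod w)"
  proof -
    have "summable (\<lambda>k. norm (inverse ((?z + of_nat k)\<^sup>2)))"
      by (rule summable_comparison_test'[OF sm]) (use bd in simp)
    then show ?thesis unfolding lorentz_sum_def
      by (intro order_trans[OF summable_norm suminf_le] bd sm)
  qed
  also have "cmod w * \<dots> \<le> pi / 2"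
    using lorentz_sum_half[of "cmod w"] assms tanh_real_lt_1[of "pi * cmod w"] by simp
  finally show ?thesis using assms by (simp add: field_simps)
qed

text \<open>As a function of t this is the derivative of \<open>t * lorentz_sum s t\<close>.\<close>

definition trigamma_re :: "real \<Rightarrow> real \<Rightarrow> real" where
  "trigamma_re s t = Re (Polygamma 1 (Complex s t))"

lemma trigamma_re_uminus:
  assumes "s > 0"
  shows "trigamma_re s (- t) = trigamma_re s t"
proof -
  have "Complex s (- t) = cnj (Complex s t)" by (simp add: complex_eq_iff)
  moreover have "Complex s t \<noteq> 0" using assms by (simp add: complex_eq_iff)
  ultimately show ?thesis unfolding trigamma_re_def using Trigamma_cnj[of "Complex s t"] by simp
qed

text \<open>The real part of pi^2 / q for q = sin^2(pi z), that is pi^2 Re q / |q|^2, where |q| =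
  cosh^2(pi t) - p.\<close>

lemma trigamma_re_reflection:
  assumes "0 < s" "s < 1"
  defines "p \<equiv> (cos (pi * s))\<^sup>2"
  shows "trigamma_re s t + trigamma_re (1 - s) t =
    pi\<^sup>2 * (p - (2 * p - 1) * (cosh (pi * t))\<^sup>2) / ((cosh (pi * t))\<^sup>2 - p)\<^sup>2"
proof -
  let ?z = "Complex s t" and ?X = "(cosh (pi * t))\<^sup>2"
  let ?s = "sin (pi * s)" and ?c = "cos (pi * s)" and ?sh = "sinh (pi * t)" and ?ch = "cosh (pi * t)"
  define W where "W = Polygamma 1 ?z + Polygamma 1 (1 - ?z)"
  have 1: "1 - ?z = Complex (1 - s) (- t)" by (simp add: complex_eq_iff)
  have ReW: "Re W = trigamma_re s t + trigamma_re (1 - s) t"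
    using trigamma_re_uminus[of "1 - s" t] assms by (simp add: W_def 1 trigamma_re_def)
  define q where "q = (sin (pi * ?z))\<^sup>2"
  have Wq: "W * q = (of_real pi)\<^sup>2" unfolding W_def q_def using assms by (intro Trigamma_reflection) auto
  have Req: "Re q = p - (2 * p - 1) * ?X"
  proof -
    have "Re q = ?s\<^sup>2 * ?ch\<^sup>2 - ?c\<^sup>2 * ?sh\<^sup>2"
      unfolding q_def sin_mult_Complex by (simp add: power2_eq_square algebra_simps)
    also have "\<dots> = (1 - p) * ?X - p * (?X - 1)"
      unfolding p_def by (simp add: sin_squared_eq cosh_square_eq)
    finally show ?thesis by (simp add: algebra_simps)
  qed
  have nq: "(cmod q)\<^sup>2 = (?X - p)\<^sup>2"
  proof -
    have "cmod q = (cmod (sin (pi * ?z)))\<^sup>2" unfolding q_def by (simp add: norm_power)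
    also have "\<dots> = ?s\<^sup>2 * ?ch\<^sup>2 + ?c\<^sup>2 * ?sh\<^sup>2"
      unfolding sin_mult_Complex by (simp add: cmod_power2 power_mult_distrib)
    also have "\<dots> = (1 - p) * ?X + p * (?X - 1)"
      unfolding p_def by (simp add: sin_squared_eq cosh_square_eq)
    finally have "cmod q = ?X - p" by (simp add: algebra_simps)
    then show ?thesis by simp
  qed
  have "q \<noteq> 0" using Wq by auto
  have "W * of_real ((cmod q)\<^sup>2) = W * q * cnj q" by (simp only: complex_norm_square mult.assoc)
  also have "\<dots> = (of_real (pi\<^sup>2)) * cnj q" unfolding Wq by simp
  finally have "Re (W * of_real ((cmod q)\<^sup>2)) = Re ((of_real (pi\<^sup>2)) * cnj q)" by (rule arg_cong)
  then have "Re W * (cmod q)\<^sup>2 = pi\<^sup>2 * Re q"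
    by (simp del: of_real_power)
  with \<open>q \<noteq> 0\<close> have "Re W = pi\<^sup>2 * Re q / (cmod q)\<^sup>2" by (simp add: field_simps)
  then show ?thesis unfolding ReW Req nq .
qed

lemma trigamma_re_half: "trigamma_re (1/2) t = pi\<^sup>2 / (2 * (cosh (pi * t))\<^sup>2)"
  using trigamma_re_reflection[of "1/2" t] by (simp add: power2_eq_square)

text \<open>For b nonzero the two summands move in opposite directions. Their sum is (4 Y + 2 - 2 v)
  / (1 + v)^2 with Y = sinh^2 b and v = Y / cosh^2 a; this decreases in v on [0, Y], and v decreases
  as a \<ge> 0 grows.\<close>

lemma sech_square_pair_mono:
  fixes a a' b :: real
  assumes "0 \<le> a" "a \<le> a'"
  shows "(cosh a)\<^sup>2 * (1 / (cosh (b + a))\<^sup>2 + 1 / (cosh (b - a))\<^sup>2) \<le>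
    (cosh a')\<^sup>2 * (1 / (cosh (b + a'))\<^sup>2 + 1 / (cosh (b - a'))\<^sup>2)"
proof -
  define Y where "Y = (sinh b)\<^sup>2"
  have Y: "Y \<ge> 0" by (simp add: Y_def)
  have *: "(cosh a)\<^sup>2 * (1 / (cosh (b + a))\<^sup>2 + 1 / (cosh (b - a))\<^sup>2) =
      (4 * Y + 2 - 2 * (Y / (cosh a)\<^sup>2)) / (1 + Y / (cosh a)\<^sup>2)\<^sup>2" for a
  proof -
    define X where "X = (cosh a)\<^sup>2"
    have X: "X > 0" by (simp add: X_def)
    have ch: "(cosh b)\<^sup>2 = Y + 1" "(sinh a)\<^sup>2 = X - 1"
      by (simp_all add: Y_def X_def cosh_square_eq)
    have prod: "cosh (b + a) * cosh (b - a) = X + Y"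
    proof -
      have "cosh (b + a) * cosh (b - a) = (cosh b)\<^sup>2 * (cosh a)\<^sup>2 - (sinh b)\<^sup>2 * (sinh a)\<^sup>2"
        by (simp add: cosh_add cosh_diff power2_eq_square algebra_simps)
      also have "\<dots> = X + Y" unfolding ch by (simp add: X_def[symmetric] Y_def[symmetric] algebra_simps)
      finally show ?thesis .
    qed
    have sum: "(cosh (b + a))\<^sup>2 + (cosh (b - a))\<^sup>2 = 4 * X * Y + 2 * X - 2 * Y"
    proof -
      have "(cosh (b + a))\<^sup>2 + (cosh (b - a))\<^sup>2 = 2 * ((cosh b)\<^sup>2 * (cosh a)\<^sup>2) + 2 * ((sinh b)\<^sup>2 * (sinh a)\<^sup>2)"
        by (simp add: cosh_add cosh_diff power2_eq_square algebra_simps)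
      also have "\<dots> = 4 * X * Y + 2 * X - 2 * Y"
        unfolding ch by (simp add: X_def[symmetric] Y_def[symmetric] algebra_simps)
      finally show ?thesis .
    qed
    have "1 / (cosh (b + a))\<^sup>2 + 1 / (cosh (b - a))\<^sup>2 =
        ((cosh (b + a))\<^sup>2 + (cosh (b - a))\<^sup>2) / (cosh (b + a) * cosh (b - a))\<^sup>2"
      by (simp add: field_simps power_mult_distrib)
    then have "X * (1 / (cosh (b + a))\<^sup>2 + 1 / (cosh (b - a))\<^sup>2) =
        X * ((4 * X * Y + 2 * X - 2 * Y) / (X + Y)\<^sup>2)"
      unfolding prod sum by simp
    also have "(X + Y)\<^sup>2 = X\<^sup>2 * (1 + Y / X)\<^sup>2"
    proof -
      have "X + Y = X * (1 + Y / X)" using X by (simp add: distrib_left)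
      then show ?thesis by (simp add: power_mult_distrib)
    qed
    also have "X * ((4 * X * Y + 2 * X - 2 * Y) / (X\<^sup>2 * (1 + Y / X)\<^sup>2)) =
        (X * (4 * X * Y + 2 * X - 2 * Y) / X\<^sup>2) / (1 + Y / X)\<^sup>2" by simp
    also have "X * (4 * X * Y + 2 * X - 2 * Y) / X\<^sup>2 = 4 * Y + 2 - 2 * (Y / X)"
      using X by (simp add: field_simps power2_eq_square)
    finally show ?thesis unfolding X_def .
  qed
  have ch: "1 \<le> cosh a" "cosh a \<le> cosh a'"
    using assms by (auto simp: cosh_real_ge_1 cosh_real_nonneg_le_iff)
  then have "1 \<le> (cosh a)\<^sup>2" "(cosh a)\<^sup>2 \<le> (cosh a')\<^sup>2" by (auto intro: power_mono)
  then have v: "Y / (cosh a')\<^sup>2 \<le> Y / (cosh a)\<^sup>2" "Y / (cosh a)\<^sup>2 \<le> Y / 1" "0 \<le> Y / (cosh a')\<^sup>2"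
    using Y divide_left_mono[of 1 "(cosh a)\<^sup>2" Y] divide_left_mono[of "(cosh a)\<^sup>2" "(cosh a')\<^sup>2" Y] by simp_all
  show ?thesis unfolding * using Y v ch
    by (intro frac_le diff_left_mono mult_left_mono power_mono) auto
qed

section \<open>Uniqueness of the critical point\<close>

lemma trigamma_re_cosh_mono:
  assumes "1/2 < u" "0 \<le> t0" "t0 \<le> t1"
  shows "(cosh (pi * t0))\<^sup>2 * trigamma_re u t0 \<le> (cosh (pi * t1))\<^sup>2 * trigamma_re u t1"
proof -
  define \<beta> where "\<beta> = (cosh (pi * t0))\<^sup>2 / (cosh (pi * t1))\<^sup>2"
  define \<sigma> where "\<sigma> = u - 1/2"
  \<comment> \<open>Pairing the translates by \<open>\<plusminus>t\<close> makes the boundary inequality hold on the whole imaginary axis,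
    where it is \<open>sech_square_pair_mono\<close>.\<close>
  let ?P = "\<lambda>z. Polygamma 1 (1/2 + z)"
  let ?f = "\<lambda>z. of_real \<beta> * (?P (z + \<i> * t0) + ?P (z - \<i> * t0)) - (?P (z + \<i> * t1) + ?P (z - \<i> * t1))"
  have \<sigma>: "\<sigma> > 0" using assms by (simp add: \<sigma>_def)
  have "cosh (pi * t0) \<le> cosh (pi * t1)" using assms by (simp add: cosh_real_nonneg_le_iff)
  then have \<beta>: "0 \<le> \<beta>" "\<beta> \<le> 1" by (auto simp: \<beta>_def divide_le_eq intro!: power_mono)
  have P: "Re (?P (Complex x y)) = trigamma_re (1/2 + x) y" for x y
  proof -
    have "1/2 + Complex x y = Complex (1/2 + x) y" by (simp add: complex_eq_iff)
    then show ?thesis by (simp only: trigamma_re_def)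
  qed
  have Re_f: "Re (?f (Complex x y)) = \<beta> * (trigamma_re (1/2 + x) (y + t0) + trigamma_re (1/2 + x) (y - t0)) -
      (trigamma_re (1/2 + x) (y + t1) + trigamma_re (1/2 + x) (y - t1))" for x y
  proof -
    have "Complex x y + \<i> * of_real t = Complex x (y + t)" "Complex x y - \<i> * of_real t = Complex x (y - t)" for t
      by (simp_all add: complex_eq_iff)
    then show ?thesis by (simp add: P del: One_nat_def)
  qed
  have "Re (?f (of_real \<sigma>)) \<le> \<eta>" if \<eta>: "\<eta> > 0" for \<eta>
  proof -
    \<comment> \<open>The summand \<sigma> keeps the test point inside the half-disc, t1 compensates
      for the vertical translates, and 2 pi / \<eta> brings the four trigamma terms on the arc below
      \<eta> in total.\<close>
    define R where "R = \<sigma> + t1 + 2 * pi / \<eta>"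
    define S where "S = {z. 0 \<le> Re z} \<inter> cball 0 R"
    have R: "R > t1" "2 * pi / (R - t1) \<le> \<eta>"
    proof -
      have "2 * pi / \<eta> > 0" using \<eta> by simp
      then show R: "R > t1" using \<sigma> by (simp add: R_def)
      have "2 * pi / \<eta> \<le> R - t1" using \<sigma> by (simp add: R_def)
      then show "2 * pi / (R - t1) \<le> \<eta>" using R \<eta> by (simp add: field_simps)
    qed
    have S: "closed S" "bounded S"
      unfolding S_def by (auto intro!: closed_Int closed_halfspace_Re_ge bounded_Int)
    have holo: "?f holomorphic_on S"
    proof -
      have "?P holomorphic_on {z. 0 \<le> Re z}"
      proof (rule holomorphic_onI)
        fix z :: complex assume "z \<in> {z. 0 \<le> Re z}"
        then have "1/2 + z \<notin> \<int>\<^sub>\<le>\<^sub>0" by (intro not_nonpos_Ints) auto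
        then have "(?P has_field_derivative Polygamma 2 (1/2 + z)) (at z within {z. 0 \<le> Re z})"
          by (auto intro!: derivative_eq_intros simp: numeral_2_eq_2)
        then show "?P field_differentiable at z within {z. 0 \<le> Re z}"
          by (auto simp: field_differentiable_def)
      qed
      then have "(?P \<circ> (\<lambda>z. z + c)) holomorphic_on S" if "Re c = 0" for c
        using that by (intro holomorphic_on_compose_gen[of _ S _ "{z. 0 \<le> Re z}"] holomorphic_intros) (auto simp: S_def)
      from this[of "\<i> * t0"] this[of "- \<i> * t0"] this[of "\<i> * t1"] this[of "- \<i> * t1"] show ?thesis
        by (intro holomorphic_intros) (simp_all add: o_def)
    qed
    have bd: "Re (?f z) \<le> \<eta>" if z: "z \<in> S" "z \<notin> interior S" for z
    proof -
      have zS: "0 \<le> Re z" "cmod z \<le> R" using z by (auto simp: S_def)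
      have "Re z = 0 \<or> cmod z = R"
      proof (rule ccontr)
        assume "\<not> ?thesis"
        then have "z \<in> {z. 0 < Re z} \<inter> ball 0 R" using zS by auto
        moreover have "open ({z. 0 < Re z} \<inter> ball 0 R)" by (intro open_Int open_halfspace_Re_gt) auto
        moreover have "{z. 0 < Re z} \<inter> ball 0 R \<subseteq> S" by (auto simp: S_def)
        ultimately show False using z by (meson interiorI)
      qed
      then show ?thesis
      proof
        assume x: "Re z = 0"
        let ?y = "Im z"
        have half: "trigamma_re (1/2) (?y + t) + trigamma_re (1/2) (?y - t) =
            pi\<^sup>2 / 2 * (1 / (cosh (pi * ?y + pi * t))\<^sup>2 + 1 / (cosh (pi * ?y - pi * t))\<^sup>2)" for t
          by (simp add: trigamma_re_half distrib_left right_diff_distrib)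
        have zc: "z = Complex 0 ?y" using x by (simp add: complex_eq_iff)
        have "Re (?f z) = Re (?f (Complex 0 ?y))" using zc by (rule arg_cong)
        also have "\<dots> = pi\<^sup>2 / 2 * (\<beta> * (1 / (cosh (pi * ?y + pi * t0))\<^sup>2 + 1 / (cosh (pi * ?y - pi * t0))\<^sup>2) -
            (1 / (cosh (pi * ?y + pi * t1))\<^sup>2 + 1 / (cosh (pi * ?y - pi * t1))\<^sup>2))"
          unfolding Re_f add_0_right half by (simp add: right_diff_distrib mult.left_commute)
        also have "\<dots> \<le> 0"
        proof -
          have "(cosh (pi * t0))\<^sup>2 * (1 / (cosh (pi * ?y + pi * t0))\<^sup>2 + 1 / (cosh (pi * ?y - pi * t0))\<^sup>2) \<le>
            (cosh (pi * t1))\<^sup>2 * (1 / (cosh (pi * ?y + pi * t1))\<^sup>2 + 1 / (cosh (pi * ?y - pi * t1))\<^sup>2)"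
            using assms by (intro sech_square_pair_mono) auto
          then have "\<beta> * (1 / (cosh (pi * ?y + pi * t0))\<^sup>2 + 1 / (cosh (pi * ?y - pi * t0))\<^sup>2) \<le>
             1 / (cosh (pi * ?y + pi * t1))\<^sup>2 + 1 / (cosh (pi * ?y - pi * t1))\<^sup>2"
            unfolding \<beta>_def times_divide_eq_left by (subst pos_divide_le_eq) (auto simp: mult.commute)
          then show ?thesis by (intro mult_nonneg_nonpos) auto
        qed
        finally show ?thesis using \<eta> by simp
      next
        assume R': "cmod z = R"
        have bd: "cmod (?P (z + \<i> * c)) \<le> pi / (2 * (R - t1))" if "\<bar>c\<bar> \<le> t1" for c :: real
        proof -
          let ?w = "z + \<i> * c"
          have "R - t1 \<le> cmod z - cmod (\<i> * c)" using that R' by (simp add: norm_mult)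
          also have "\<dots> \<le> cmod ?w" by (rule norm_diff_ineq)
          finally have w: "R - t1 \<le> cmod ?w" .
          then have "?w \<noteq> 0" using R by auto
          then have "cmod (?P ?w) \<le> pi / (2 * cmod ?w)" using zS by (intro norm_Trigamma_le) auto
          also have "\<dots> \<le> pi / (2 * (R - t1))" using w R by (intro divide_left_mono mult_pos_pos) auto
          finally show ?thesis .
        qed
        have "Re (?f z) \<le> cmod (?f z)" by (rule complex_Re_le_cmod)
        also have "\<dots> \<le> cmod (of_real \<beta> * (?P (z + \<i> * t0) + ?P (z - \<i> * t0))) + cmod (?P (z + \<i> * t1) + ?P (z - \<i> * t1))"
          by (rule norm_triangle_ineq4)
        also have "\<dots> \<le> 1 * (cmod (?P (z + \<i> * t0)) + cmod (?P (z - \<i> * t0))) + (cmod (?P (z + \<i> * t1)) + cmod (?P (z - \<i> * t1)))"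
          unfolding norm_mult using \<beta> by (intro add_mono mult_mono norm_triangle_ineq) auto
        also have "\<dots> \<le> 4 * (pi / (2 * (R - t1)))"
          using bd[of t0] bd[of "- t0"] bd[of t1] bd[of "- t1"] assms by simp
        also have "\<dots> = 2 * pi / (R - t1)" using R(1) by (simp add: field_simps)
        finally show ?thesis using R by simp
      qed
    qed
    have \<sigma>S: "of_real \<sigma> \<in> S"
    proof -
      have "0 \<le> t1 + 2 * pi / \<eta>" using assms \<eta> by (intro add_nonneg_nonneg) auto
      then show ?thesis using \<sigma> by (simp add: S_def R_def)
    qed
    show ?thesis using holo S bd \<sigma>S by (rule max_principle_Re)
  qed
  then have "Re (?f (of_real \<sigma>)) \<le> 0 + \<eta>" if "\<eta> > 0" for \<eta> using that by (simp only: add_0)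
  then have "Re (?f (of_real \<sigma>)) \<le> 0" by (rule field_le_epsilon)
  \<comment> \<open>At a real point the two translates of a pair are conjugate, so the pairing is
    undone up to the factor 2.\<close>
  moreover have "Re (?f (of_real \<sigma>)) = 2 * (\<beta> * trigamma_re u t0 - trigamma_re u t1)"
    using Re_f[of \<sigma> 0] trigamma_re_uminus[of u] assms unfolding complex_of_real_def
    by (simp add: \<sigma>_def algebra_simps)
  ultimately have "\<beta> * trigamma_re u t0 \<le> trigamma_re u t1" by simp
  then show ?thesis by (simp add: \<beta>_def field_simps)
qed

text \<open>Positivity spreads from the real axis, where \<open>Polygamma 1 u\<close> is positive,
  by monotonicity from t0 = 0.\<close>

lemma trigamma_re_pos:
  assumes "1/2 < u"
  shows "trigamma_re u t > 0"
proof -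
  have "trigamma_re u 0 = Polygamma 1 u"
    using assms Polygamma_of_real[of u 1, where 'a = complex]
    by (simp add: trigamma_re_def complex_of_real_def[symmetric])
  also have "\<dots> > 0" using assms by (intro Polygamma_real_odd_pos) (auto elim!: nonpos_Ints_cases)
  finally have "0 < (cosh (pi * 0))\<^sup>2 * trigamma_re u 0" by simp
  also have "\<dots> \<le> (cosh (pi * \<bar>t\<bar>))\<^sup>2 * trigamma_re u \<bar>t\<bar>"
    using assms by (intro trigamma_re_cosh_mono) auto
  finally have "trigamma_re u \<bar>t\<bar> > 0" by (simp add: zero_less_mult_iff)
  then show ?thesis using trigamma_re_uminus[of u t] assms by (cases "t \<ge> 0") auto
qed

lemma has_real_derivative_lorentz_sum:
  assumes "s > 0"
  shows "((\<lambda>t. t * lorentz_sum s t) has_real_derivative trigamma_re s t) (at t)"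
proof -
  have "of_real s + \<i> * of_real t \<notin> \<int>\<^sub>\<le>\<^sub>0" using assms by (intro not_nonpos_Ints) simp
  then have "((\<lambda>z. Digamma (of_real s + \<i> * z)) has_field_derivative
      \<i> * Polygamma 1 (of_real s + \<i> * of_real t)) (at (of_real t))"
    by (auto intro!: derivative_eq_intros)
  then have "((\<lambda>t. Digamma (of_real s + \<i> * of_real t)) has_vector_derivative
      \<i> * Polygamma 1 (of_real s + \<i> * of_real t)) (at t)"
    by (rule has_vector_derivative_real_field)
  then have "((\<lambda>t. Im (Digamma (of_real s + \<i> * of_real t))) has_vector_derivative
      Im (\<i> * Polygamma 1 (of_real s + \<i> * of_real t))) (at t)"
    by (rule bounded_linear.has_vector_derivative[OF bounded_linear_Im])
  moreover have "of_real s + \<i> * of_real t = Complex s t" for t by (simp add: complex_eq_iff)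
  ultimately show ?thesis
    by (simp add: Im_Digamma[OF assms] trigamma_re_def has_real_derivative_iff_has_vector_derivative)
qed

lemma trigamma_re_zero_unique:
  assumes s: "0 < s" "s < 1/2" and t: "0 < t0" "t0 < t1"
    and zero: "trigamma_re s t0 = 0" "trigamma_re s t1 = 0"
  shows False
proof -
  define p where "p = (cos (pi * s))\<^sup>2"
  have p: "0 < p" "p < 1"
  proof -
    have "cos (pi * s) > 0" using s by (intro cos_gt_zero) auto
    moreover have "cos (pi * s) < 1" using s cos_monotone_0_pi[of 0 "pi * s"] by simp
    ultimately show "0 < p" "p < 1" using power_strict_mono[of "cos (pi * s)" 1 2] by (auto simp: p_def)
  qed
  have eq: "(cosh (pi * t))\<^sup>2 * trigamma_re (1 - s) t = pi\<^sup>2 * ((p / (cosh (pi * t))\<^sup>2 + 1 - 2 * p) / (1 - p / (cosh (pi * t))\<^sup>2)\<^sup>2)"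
    if "trigamma_re s t = 0" for t
  proof -
    define X where "X = (cosh (pi * t))\<^sup>2"
    have X: "X \<ge> 1" unfolding X_def by (simp add: cosh_real_ge_1)
    have "trigamma_re (1 - s) t = pi\<^sup>2 * (p - (2 * p - 1) * X) / (X - p)\<^sup>2"
      using trigamma_re_reflection[of s t] s that unfolding X_def p_def by simp
    moreover have "X - p = X * (1 - p / X)" "X * (p - (2 * p - 1) * X) = X\<^sup>2 * (p / X + 1 - 2 * p)"
      using X by (simp_all add: field_simps power2_eq_square)
    ultimately show ?thesis using X unfolding X_def[symmetric]
      by (simp add: power_mult_distrib mult.left_commute[of X])
  qed
  \<comment> \<open>In this variable the right side of \<open>eq\<close> is pi^2 (v + 1 - 2 p) / (1
    - v)^2, increasing in v < 1 as long as the numerator is positive, while v decreases in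
    t.\<close>
  define v where "v = (\<lambda>t. p / (cosh (pi * t))\<^sup>2)"
  have "cosh (pi * t0) < cosh (pi * t1)" using t by (simp add: cosh_real_nonneg_less_iff)
  then have "(cosh (pi * t0))\<^sup>2 < (cosh (pi * t1))\<^sup>2" by (intro power_strict_mono) auto
  then have v10: "v t1 < v t0" unfolding v_def using p by (intro divide_strict_left_mono mult_pos_pos) auto
  have "1 \<le> (cosh (pi * t0))\<^sup>2" by (simp add: cosh_real_ge_1)
  then have v0: "v t0 < 1" unfolding v_def using p by (simp add: divide_less_eq)
  have u: "1/2 < 1 - s" using s by simp
  \<comment> \<open>For p > 1/2 the sign of the numerator is not evident; positivity of Re psi' to
    the right of 1/2 settles it.\<close>
  have "(cosh (pi * t1))\<^sup>2 * trigamma_re (1 - s) t1 > 0" using trigamma_re_pos[OF u, of t1] by simp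
  then have "pi\<^sup>2 * ((v t1 + 1 - 2 * p) / (1 - v t1)\<^sup>2) > 0" unfolding eq[OF zero(2)] v_def .
  then have N1: "v t1 + 1 - 2 * p > 0" by (auto simp: zero_less_mult_iff zero_less_divide_iff)
  have "(v t1 + 1 - 2 * p) / (1 - v t1)\<^sup>2 < (v t0 + 1 - 2 * p) / (1 - v t0)\<^sup>2"
    using v10 v0 N1 by (intro frac_less power_mono) auto
  then have "(cosh (pi * t1))\<^sup>2 * trigamma_re (1 - s) t1 < (cosh (pi * t0))\<^sup>2 * trigamma_re (1 - s) t0"
    unfolding eq[OF zero(1)] eq[OF zero(2)] v_def by (intro mult_strict_left_mono) auto
  moreover have "(cosh (pi * t0))\<^sup>2 * trigamma_re (1 - s) t0 \<le> (cosh (pi * t1))\<^sup>2 * trigamma_re (1 - s) t1"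
    using t by (intro trigamma_re_cosh_mono[OF u]) auto
  ultimately show False by simp
qed

section \<open>Existence and uniqueness of the maximum\<close>

lemma lorentz_sum_exceeds:
  assumes "0 < s" "s < 1/2"
  shows "\<exists>t>0. t * lorentz_sum s t > pi / 2"
proof -
  define \<sigma> where "\<sigma> = 1/2 - s"
  have \<sigma>: "\<sigma> > 0" using assms by (simp add: \<sigma>_def)
  \<comment> \<open>By reflection t L is at least pi tanh(pi t) - arctan(t / \<sigma>), whose excess
    over pi / 2 is at least arctan(\<sigma> / t) minus an exponentially small error; the former
    decays only like \<sigma> / t.\<close>
  have "((\<lambda>t. t * (arctan (\<sigma> / t) - 2 * pi * exp (- 2 * pi * t))) \<longlongrightarrow> \<sigma>) at_top"
    using \<sigma> by real_asymp
  then have "\<forall>\<^sub>F t in at_top. t * (arctan (\<sigma> / t) - 2 * pi * exp (- 2 * pi * t)) > 0"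
    using \<sigma> by (rule order_tendstoD)
  then have "\<forall>\<^sub>F t in at_top. t > 0 \<and> arctan (\<sigma> / t) - 2 * pi * exp (- 2 * pi * t) > 0"
    using eventually_gt_at_top[of 0] by eventually_elim (simp add: zero_less_mult_iff)
  then obtain t where t: "t > 0" "arctan (\<sigma> / t) - 2 * pi * exp (- 2 * pi * t) > 0"
    by (auto simp: eventually_at_top_linorder)
  have "tanh (pi * t) \<ge> 1 - 2 * exp (- 2 * pi * t)"
  proof -
    have "1 - 2 * e \<le> (1 - e) / (1 + e)" if "e > 0" for e :: real
      using that by (simp add: field_simps)
    then show ?thesis unfolding tanh_real_altdef by (simp add: mult.assoc)
  qed
  then have "pi * (1 - 2 * exp (- 2 * pi * t)) \<le> pi * tanh (pi * t)" by (intro mult_left_mono) auto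
  then have t2: "pi * tanh (pi * t) - arctan (t / \<sigma>) - pi / 2 > 0"
    using t arctan_complement[OF t(1) \<sigma>] arctan_complement[OF \<sigma> t(1)] by (simp add: algebra_simps)
  let ?sh = "sinh (pi * t)" and ?ch = "cosh (pi * t)"
  have "(sin (pi * s))\<^sup>2 \<le> 1" by (simp add: abs_square_le_1)
  moreover have "?sh > 0" using t by simp
  ultimately have "pi * ?sh * ?ch / ?ch\<^sup>2 \<le> pi * ?sh * ?ch / ((sin (pi * s))\<^sup>2 + ?sh\<^sup>2)"
    by (intro divide_left_mono mult_pos_pos add_nonneg_pos mult_nonneg_nonneg) (auto simp: cosh_square_eq intro!: add_nonneg_pos)
  also have "\<dots> = t * lorentz_sum s t + t * lorentz_sum (1 - s) t"
    using lorentz_sum_reflection[of s t] assms t by simp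
  also have "t * lorentz_sum (1 - s) t \<le> arctan (t / \<sigma>)"
    using lorentz_sum_le_arctan_half[OF \<sigma> t(1)] by (simp add: \<sigma>_def)
  finally have "pi * tanh (pi * t) \<le> t * lorentz_sum s t + arctan (t / \<sigma>)"
    by (simp add: tanh_def power2_eq_square)
  with t(1) t2 show ?thesis by (intro exI[of _ t]) linarith
qed

lemma lorentz_sum_max_exists:
  assumes "0 < s" "s < 1/2"
  shows "\<exists>t>0. \<forall>t'>0. t' * lorentz_sum s t' \<le> t * lorentz_sum s t"
proof -
  let ?y = "\<lambda>t. t * lorentz_sum s t"
  obtain t0 where t0: "t0 > 0" "?y t0 > pi / 2" using lorentz_sum_exceeds[OF assms] by blast
  \<comment> \<open>Beyond T the upper bound pi / 2 + 1 / t' no longer exceeds \<open>?y t0\<close>,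
    so a maximum over the compact interval is global.\<close>
  define T where "T = max t0 (1 / (?y t0 - pi / 2))"
  have T: "T > 0" "t0 \<le> T" "1 / (?y t0 - pi / 2) \<le> T" using t0 by (auto simp: T_def)
  have "continuous_on {0..T} ?y"
    using has_real_derivative_lorentz_sum[OF assms(1)] by (meson DERIV_isCont continuous_at_imp_continuous_on)
  then obtain t where t: "t \<in> {0..T}" "\<And>t'. t' \<in> {0..T} \<Longrightarrow> ?y t' \<le> ?y t"
    using continuous_attains_sup[of "{0..T}" ?y] T by auto
  have ge: "?y t0 \<le> ?y t" using t(2)[of t0] t0 T by simp
  have "pi / 2 > 0" by simp
  then have "?y t > 0" using ge t0 by linarith
  then have "t > 0" using t(1) by (cases "t = 0") auto
  moreover have "?y t' \<le> ?y t" if "t' > 0" for t'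
  proof (cases "t' \<le> T")
    case True
    then show ?thesis using t that by simp
  next
    case False
    then have t': "t' > T" by simp
    have "?y t' \<le> t' / (s\<^sup>2 + t'\<^sup>2) + arctan (t' / s)" using assms that by (intro lorentz_sum_le_arctan) auto
    also have "t' / (s\<^sup>2 + t'\<^sup>2) \<le> t' / t'\<^sup>2"
      using that by (intro divide_left_mono mult_pos_pos add_nonneg_pos) auto
    also have "t' / t'\<^sup>2 = 1 / t'" by (simp add: power2_eq_square)
    also have "1 / t' \<le> ?y t0 - pi / 2"
    proof -
      have "1 / (?y t0 - pi / 2) \<le> t'" using T t' by linarith
      then show ?thesis using t0 that by (simp add: field_simps)
    qed
    also have "arctan (t' / s) \<le> pi / 2" using arctan_ubound[of "t' / s"] by simp
    finally show ?thesis using ge by simp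
  qed
  ultimately show ?thesis by blast
qed

lemma lorentz_sum_max_unique:
  assumes "0 < s" "s < 1/2"
    and "t0 > 0" "\<And>t. t > 0 \<Longrightarrow> t * lorentz_sum s t \<le> t0 * lorentz_sum s t0"
    and "t1 > 0" "\<And>t. t > 0 \<Longrightarrow> t * lorentz_sum s t \<le> t1 * lorentz_sum s t1"
  shows "t0 = t1"
proof -
  have zero: "trigamma_re s t = 0" if "t > 0" "\<And>t'. t' > 0 \<Longrightarrow> t' * lorentz_sum s t' \<le> t * lorentz_sum s t" for t
    \<comment> \<open>The radius of the neighbourhood is t itself, so all points compared are
      positive.\<close>
    by (rule DERIV_local_max[OF has_real_derivative_lorentz_sum[OF assms(1)] \<open>t > 0\<close>]) (use that in auto)
  have "trigamma_re s t0 = 0" "trigamma_re s t1 = 0" using assms by (auto intro!: zero)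
  then show ?thesis using trigamma_re_zero_unique[OF assms(1,2)] assms(3,5)
    by (metis linorder_neq_iff)
qed

section \<open>Extremals\<close>

text \<open>This t balances t^2 A against B, the equality case of B + t^2 A \<ge> 2 t sqrt(A
  B).\<close>

lemma suminf_square_le_sqrt:
  assumes adm: "admissible (1 - s) a" and s: "s > 0" and nz: "a n \<noteq> 0"
  defines "t \<equiv> sqrt (wsq_sum (1 - s) a / sq_sum a)"
  shows "t > 0" "(wsq_sum (1 - s) a + t\<^sup>2 * sq_sum a) * lorentz_sum s t =
      2 * (t * lorentz_sum s t) * (sqrt (sq_sum a) * sqrt (wsq_sum (1 - s) a))"
    "(suminf a)\<^sup>2 \<le> 2 * (t * lorentz_sum s t) * (sqrt (sq_sum a) * sqrt (wsq_sum (1 - s) a))"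
proof -
  let ?A = "sq_sum a" and ?B = "wsq_sum (1 - s) a"
  have AB: "?A > 0" "?B > 0" using sq_sum_bounds[OF adm s] nz by auto
  then show t: "t > 0" by (simp add: t_def)
  have "t\<^sup>2 * ?A = ?B" using AB by (simp add: t_def)
  moreover have "sqrt ?A * sqrt ?B = ?A * t" unfolding t_def using AB by (intro sqrt_mult_eq_mult_sqrt_divide) auto
  ultimately show eq: "(?B + t\<^sup>2 * ?A) * lorentz_sum s t = 2 * (t * lorentz_sum s t) * (sqrt ?A * sqrt ?B)"
    by (simp add: power2_eq_square algebra_simps)
  show "(suminf a)\<^sup>2 \<le> 2 * (t * lorentz_sum s t) * (sqrt ?A * sqrt ?B)"
    using suminf_square_le[OF adm s t] unfolding eq .
qed

text \<open>The two energies of \<open>e\<close> are never computed separately. AM-GM on their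
  weighted sum gives k sqrt(A B) \<le> L^2, the general inequality gives the converse, and the
  resulting equality makes k least.\<close>

lemma carlson_extremal:
  assumes s: "s > 0" and t: "t > 0"
    and max: "\<And>t'. t' > 0 \<Longrightarrow> t' * lorentz_sum s t' \<le> t * lorentz_sum s t"
  defines "e \<equiv> \<lambda>n. 1 / ((real n + s)\<^sup>2 + t\<^sup>2)" and "k \<equiv> 2 * (t * lorentz_sum s t)"
  shows "k \<in> carlson_consts (1 - s)" "\<And>C. C \<in> carlson_consts (1 - s) \<Longrightarrow> k \<le> C"
    "admissible (1 - s) e" "(suminf e)\<^sup>2 = k * sqrt (sq_sum e) * sqrt (wsq_sum (1 - s) e)"
proof -
  have le: "(suminf a)\<^sup>2 \<le> k * sqrt (sq_sum a) * sqrt (wsq_sum (1 - s) a)" if adm: "admissible (1 - s) a" for a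
  proof (cases "\<exists>n. a n \<noteq> 0")
    case True
    then obtain n where n: "a n \<noteq> 0" ..
    define u where "u = sqrt (wsq_sum (1 - s) a / sq_sum a)"
    note u = suminf_square_le_sqrt[OF adm s n, folded u_def]
    have "(suminf a)\<^sup>2 \<le> 2 * (u * lorentz_sum s u) * (sqrt (sq_sum a) * sqrt (wsq_sum (1 - s) a))"
      by (rule u)
    also have "\<dots> \<le> k * (sqrt (sq_sum a) * sqrt (wsq_sum (1 - s) a))"
      unfolding k_def using max[OF u(1)] sq_sum_bounds(3,4)[OF adm s n] by (intro mult_right_mono) auto
    finally show ?thesis by (simp add: mult.assoc)
  next
    case False
    then have "a = (\<lambda>_. 0)" by auto
    then show ?thesis by (simp add: sq_sum_def)
  qed
  then show "k \<in> carlson_consts (1 - s)" by (simp add: carlson_consts_def)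
  show adm: "admissible (1 - s) e" unfolding e_def using s by (rule admissible_lorentz)
  have e0: "e 0 \<noteq> 0" using s by (simp add: e_def sum_power2_eq_zero_iff)
  let ?A = "sq_sum e" and ?B = "wsq_sum (1 - s) e"
  have AB: "?A > 0" "?B > 0" using sq_sum_bounds[OF adm s] e0 by auto
  have E: "suminf e = lorentz_sum s t" "?B + t\<^sup>2 * ?A = lorentz_sum s t"
    using lorentz_energy[OF s t] by (simp_all add: e_def)
  have "0 \<le> (sqrt ?B - t * sqrt ?A)\<^sup>2" by simp
  also have "\<dots> = lorentz_sum s t - 2 * t * (sqrt ?A * sqrt ?B)"
    unfolding E(2)[symmetric] using AB by (simp add: power2_diff power_mult_distrib)
  finally have "2 * t * (sqrt ?A * sqrt ?B) * lorentz_sum s t \<le> lorentz_sum s t * lorentz_sum s t"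
    using lorentz_sum_pos[OF s, of t] by (intro mult_right_mono) auto
  then have "k * sqrt ?A * sqrt ?B \<le> (suminf e)\<^sup>2" unfolding E k_def by (simp add: power2_eq_square mult_ac)
  with le[OF adm] show eq: "(suminf e)\<^sup>2 = k * sqrt ?A * sqrt ?B" by simp
  show "k \<le> C" if "C \<in> carlson_consts (1 - s)" for C
  proof -
    have "k * sqrt ?A * sqrt ?B \<le> C * sqrt ?A * sqrt ?B"
      using that adm unfolding carlson_consts_def eq[symmetric] by blast
    then show ?thesis using AB by simp
  qed
qed

text \<open>Equality forces the balancing parameter u of \<open>a\<close> to maximise t L as well,
  so u = t by uniqueness of the maximum; then the equality case of Cauchy-Schwarz determines
  \<open>a\<close> up to a factor.\<close>

lemma carlson_extremal_unique:
  assumes s: "0 < s" "s < 1/2" and t: "t > 0"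
    and max: "\<And>t'. t' > 0 \<Longrightarrow> t' * lorentz_sum s t' \<le> t * lorentz_sum s t"
    and adm: "admissible (1 - s) a" and nz: "a m \<noteq> 0"
    and eq: "(suminf a)\<^sup>2 = 2 * (t * lorentz_sum s t) * sqrt (sq_sum a) * sqrt (wsq_sum (1 - s) a)"
  shows "\<exists>c. \<forall>n. a n = c * (1 / ((real n + s)\<^sup>2 + t\<^sup>2))"
proof -
  define u where "u = sqrt (wsq_sum (1 - s) a / sq_sum a)"
  note u = suminf_square_le_sqrt[OF adm s(1) nz, folded u_def]
  have AB: "sqrt (sq_sum a) * sqrt (wsq_sum (1 - s) a) > 0"
    using sq_sum_bounds[OF adm s(1)] nz by auto
  have "(t * lorentz_sum s t) * (sqrt (sq_sum a) * sqrt (wsq_sum (1 - s) a)) \<le>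
      (u * lorentz_sum s u) * (sqrt (sq_sum a) * sqrt (wsq_sum (1 - s) a))"
    using u(3) eq by (simp add: mult.assoc)
  then have tu: "t * lorentz_sum s t \<le> u * lorentz_sum s u" using AB by (simp only: mult_le_cancel_right_pos)
  then have "u = t"
    using max by (intro lorentz_sum_max_unique[OF s u(1) _ t]) (auto intro: order_trans)
  then have "(suminf a)\<^sup>2 = (wsq_sum (1 - s) a + t\<^sup>2 * sq_sum a) * lorentz_sum s t"
    using u(2) eq by (auto simp: mult.assoc)
  from suminf_square_eqD[OF adm s(1) t this] show ?thesis by blast
qed

theorem theorem5p2:
  shows
  "(\<forall>\<alpha>::real. 0 \<le> \<alpha> \<and> \<alpha> < 1/2 \<longrightarrow>
      (\<forall>a. admissible \<alpha> a \<longrightarrow>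
         (suminf a)^2 \<le> pi * sqrt (sq_sum a) * sqrt (wsq_sum \<alpha> a) - (1 - 2*\<alpha>) * sq_sum a)
    \<and> (\<forall>C < pi. \<exists>a. admissible \<alpha> a \<and>
         (suminf a)^2 > C * sqrt (sq_sum a) * sqrt (wsq_sum \<alpha> a) - (1 - 2*\<alpha>) * sq_sum a)
    \<and> (\<forall>\<gamma> > 1 - 2*\<alpha>. \<exists>a. admissible \<alpha> a \<and>
         (suminf a)^2 > pi * sqrt (sq_sum a) * sqrt (wsq_sum \<alpha> a) - \<gamma> * sq_sum a)
    \<and> (\<forall>a. admissible \<alpha> a \<and> (\<exists>n. a n \<noteq> 0) \<longrightarrow>
         (suminf a)^2 \<noteq> pi * sqrt (sq_sum a) * sqrt (wsq_sum \<alpha> a) - (1 - 2*\<alpha>) * sq_sum a))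
 \<and>
   (\<forall>\<alpha>::real. 1/2 < \<alpha> \<and> \<alpha> < 1 \<longrightarrow>
      (\<exists>!lamS. lamS > 0 \<and> (\<forall>l>0. psi_expr \<alpha> l \<le> psi_expr \<alpha> lamS))
    \<and> (\<forall>lamS. lamS > 0 \<and> (\<forall>l>0. psi_expr \<alpha> l \<le> psi_expr \<alpha> lamS) \<longrightarrow>
         (psi_expr \<alpha> lamS \<in> carlson_consts \<alpha> \<and> (\<forall>C \<in> carlson_consts \<alpha>. psi_expr \<alpha> lamS \<le> C))
       \<and> (let e = (\<lambda>n. 1 / ((real (Suc n) - \<alpha>)^2 + lamS)) in
            admissible \<alpha> e
          \<and> (suminf e)^2 = psi_expr \<alpha> lamS * sqrt (sq_sum e) * sqrt (wsq_sum \<alpha> e)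
          \<and> (\<forall>a. admissible \<alpha> a \<and> (\<exists>n. a n \<noteq> 0)
                 \<and> (suminf a)^2 = psi_expr \<alpha> lamS * sqrt (sq_sum a) * sqrt (wsq_sum \<alpha> a)
                 \<longrightarrow> (\<exists>c. \<forall>n. a n = c * e n)))))"
proof (intro conjI allI impI; (elim conjE)?)
  fix \<alpha> :: real assume \<alpha>: "0 \<le> \<alpha>" "\<alpha> < 1/2"
  define s where "s = 1 - \<alpha>"
  have s: "1/2 < s" "s \<le> 1" "\<alpha> = 1 - s" using \<alpha> by (auto simp: s_def)
  have strict: "(suminf a)\<^sup>2 < pi * sqrt (sq_sum a) * sqrt (wsq_sum \<alpha> a) - (1 - 2*\<alpha>) * sq_sum a"
    if "admissible \<alpha> a" "a n \<noteq> 0" for a n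
    using defect_inequality_strict[of s a n] that s by simp
  show "(suminf a)\<^sup>2 \<le> pi * sqrt (sq_sum a) * sqrt (wsq_sum \<alpha> a) - (1 - 2*\<alpha>) * sq_sum a"
    if "admissible \<alpha> a" for a
  proof (cases "\<exists>n. a n \<noteq> 0")
    case False
    then have "a = (\<lambda>_. 0)" by auto
    then show ?thesis by (simp add: sq_sum_def)
  qed (use strict that less_imp_le in blast)
  show "(suminf a)\<^sup>2 \<noteq> pi * sqrt (sq_sum a) * sqrt (wsq_sum \<alpha> a) - (1 - 2*\<alpha>) * sq_sum a"
    if "admissible \<alpha> a" "\<exists>n. a n \<noteq> 0" for a
    using strict that by (metis less_irrefl)
  show "\<exists>a. admissible \<alpha> a \<and>
      (suminf a)\<^sup>2 > C * sqrt (sq_sum a) * sqrt (wsq_sum \<alpha> a) - (1 - 2*\<alpha>) * sq_sum a" if "C < pi" for C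
    using leading_constant_sharp[OF s(1) that] s(3) by simp
  show "\<exists>a. admissible \<alpha> a \<and>
      (suminf a)\<^sup>2 > pi * sqrt (sq_sum a) * sqrt (wsq_sum \<alpha> a) - \<gamma> * sq_sum a" if "\<gamma> > 1 - 2*\<alpha>" for \<gamma>
    using defect_constant_sharp[OF s(1), of \<gamma>] that s(3) by auto
next
  fix \<alpha> :: real assume \<alpha>: "1/2 < \<alpha>" "\<alpha> < 1"
  define s where "s = 1 - \<alpha>"
  have s: "0 < s" "s < 1/2" "\<alpha> = 1 - s" using \<alpha> by (auto simp: s_def)
  let ?y = "\<lambda>t. t * lorentz_sum s t"
  have psi: "psi_expr \<alpha> l = 2 * ?y (sqrt l)" for l
    using psi_expr_eq[OF \<alpha>(2)] by (simp add: s_def)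
  \<comment> \<open>The substitution l = t^2 carries maximality over l > 0 to maximality over t >
    0.\<close>
  have max: "?y t \<le> ?y (sqrt lamS)"
    if "\<forall>l>0. psi_expr \<alpha> l \<le> psi_expr \<alpha> lamS" "t > 0" for lamS t
    using that(1)[rule_format, of "t\<^sup>2"] that(2) unfolding psi by simp
  show "\<exists>!lamS. lamS > 0 \<and> (\<forall>l>0. psi_expr \<alpha> l \<le> psi_expr \<alpha> lamS)"
  proof (rule ex_ex1I)
    obtain t where "t > 0" "\<forall>t'>0. ?y t' \<le> ?y t" using lorentz_sum_max_exists[OF s(1,2)] by blast
    then show "\<exists>lamS. lamS > 0 \<and> (\<forall>l>0. psi_expr \<alpha> l \<le> psi_expr \<alpha> lamS)"
      unfolding psi by (intro exI[of _ "t\<^sup>2"]) auto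
  next
    fix l l' assume "l > 0 \<and> (\<forall>k>0. psi_expr \<alpha> k \<le> psi_expr \<alpha> l)"
      and "l' > 0 \<and> (\<forall>k>0. psi_expr \<alpha> k \<le> psi_expr \<alpha> l')"
    then have "sqrt l = sqrt l'" by (intro lorentz_sum_max_unique[OF s(1,2)] max) auto
    then show "l = l'" by simp
  qed
  fix lamS assume lam: "lamS > 0" and mx: "\<forall>l>0. psi_expr \<alpha> l \<le> psi_expr \<alpha> lamS"
  define t where "t = sqrt lamS"
  have t: "t > 0" "t\<^sup>2 = lamS" using lam by (simp_all add: t_def)
  have psi_t: "psi_expr \<alpha> lamS = 2 * ?y t" by (simp add: psi t_def)
  have max_t: "?y t' \<le> ?y t" if "t' > 0" for t' unfolding t_def using mx that by (rule max)
  have e: "real (Suc n) - \<alpha> = real n + s" for n by (simp add: s_def)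
  note ex = carlson_extremal[OF s(1) t(1) max_t, folded s(3)]
  show "psi_expr \<alpha> lamS \<in> carlson_consts \<alpha>" unfolding psi_t using ex(1) .
  show "\<forall>C \<in> carlson_consts \<alpha>. psi_expr \<alpha> lamS \<le> C" unfolding psi_t using ex(2) by blast
  show "let e = (\<lambda>n. 1 / ((real (Suc n) - \<alpha>)^2 + lamS)) in
            admissible \<alpha> e
          \<and> (suminf e)^2 = psi_expr \<alpha> lamS * sqrt (sq_sum e) * sqrt (wsq_sum \<alpha> e)
          \<and> (\<forall>a. admissible \<alpha> a \<and> (\<exists>n. a n \<noteq> 0)
                 \<and> (suminf a)^2 = psi_expr \<alpha> lamS * sqrt (sq_sum a) * sqrt (wsq_sum \<alpha> a)
                 \<longrightarrow> (\<exists>c. \<forall>n. a n = c * e n))"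
    unfolding Let_def e psi_t unfolding t(2)[symmetric]
    using ex(3,4) carlson_extremal_unique[OF s(1,2) t(1) max_t, folded s(3)] by blast
qed

end
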